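(* Let $\alpha\in(0,1)$, $\sigma=1-\alpha/2$, $\nu>0$, let $\Omega\subset\mathbb R^d$ be a bounded Lipschitz domain, and fix $\varepsilon$, $\Delta t$, $T_{\rm soe}$ and a sum-of-exponentials (SOE) approximation as in the context. Consider the semilinear subdiffusion equation $\partial_t^\alpha u=\nu^2\Delta u-f(u)$ in $(0,\infty)\times\Omega$, $u(0,\cdot)=u^0$, with periodic or homogeneous Dirichlet or homogeneous Neumann boundary condition. Assume that $f$ satisfies $\sup_{u\in\mathbb R}|f'(u)|\le L$ for some constant $L>0$. Let $\{\tau_k\}_{k\ge1}$ be an arbitrary nonuniform mesh satisfying $$\rho_k\ge \eta\ \ (k\ge 2),\qquad \varepsilon\le \min_{k\ge1}\frac{1}{5(1-\alpha)(\sigma\tau_k)^\alpha},\qquad \Delta t\le \min_{k\ge2}\sigma\tau_k,\qquad T_{\rm soe}\ge\max_{k\ge2}(\sigma\tau_{k+1}+\tau_k),$$ where $\rho_k=\tau_k/\tau_{k-1}$ and $\eta\approx0.475329$ is the unique positive root of $1-3\rho^2(1+\rho)=0$, and also $$\tau_1^\alpha\le\frac{2-\alpha-(1-\alpha)\eta^{-\alpha}}{\sigma^\alpha[(3-\alpha)\Gamma(2-\alpha)L+(1-\alpha)\varepsilon]},\qquad \tau_k^\alpha\le\frac{1-(1-\alpha)\sigma^\alpha[(\sigma\eta)^{-\alpha}-(\sigma\eta+1)^{-\alpha}]}{\sigma^\alpha[(3-\alpha)\Gamma(2-\alpha)L+3(1-\alpha)\varepsilon]}\quad(k\ge2).$$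 Then the numerical solution $u^n$ of the fast L2-1$_\sigma$ scheme $$F_k^{\alpha,*}u=(1-\alpha/2)\nu^2\Delta u^k+(\alpha/2)\nu^2\Delta u^{k-1}-f(u^{k-1})-(1-\alpha/2)f'(u^{k-1})\delta_ku\quad\text{in }\Omega,\ k\ge1,$$ satisfies the energy stability $$\int_\Omega\Big(\frac{\nu^2}2|\nabla u^n|^2+F(u^n)\Big)dx\le\int_\Omega\Big(\frac{\nu^2}2|\nabla u^0|^2+F(u^0)\Big)dx,\qquad\forall n\ge1,$$ where $F$ is a primitive integral of $f$, i.e. $F'(u)=f(u)$.
   Context: The Caputo derivative is $\partial_t^\alpha u(t)=\frac1{\Gamma(1-\alpha)}\int_0^t\frac{u'(s)}{(t-s)^\alpha}\,ds$. Mesh: $0=t_0<t_1<t_2<\cdots$, $\tau_k=t_k-t_{k-1}$ ($k\ge1$), $t_k^*=t_{k-1}+\sigma\tau_k$. For a sequence $u^0,u^1,\dots$, $\delta_ku=u^k-u^{k-1}$. In the scheme, $u^0$ is the initial value and each $u^k$ satisfies the boundary condition of the equation. SOE approximation: given an absolute tolerance error $\varepsilon\ll1$, a cut-off time $\Delta t>0$ and a fixed time $T_{\rm soe}>\Delta t$, there exist (by a known result) a positive integer $N_q$, positive nodes $\theta^\ell$ and positive weights $\varpi^\ell$ ($1\le\ell\le N_q$) such that $\big|t^{-\alpha}-\sum_{\ell=1}^{N_q}\varpi^\ell e^{-\theta^\ell t}\big|\le\varepsilon$ for all $t\in[\Delta t,T_{\rm soe}]$; these are fixed. $T_{\rm soe}$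 is not necessarily the total time: the times $t_k$ may exceed it. Coefficients: for $1\le j\le k-1$, $$\hat a_j^{(k)}=\int_{t_{j-1}}^{t_j}\frac{2s-t_j-t_{j+1}}{\tau_j(\tau_j+\tau_{j+1})}\sum_{\ell=1}^{N_q}\varpi^\ell e^{-\theta^\ell(t_k^*-s)}\,ds,\qquad \hat c_j^{(k)}=\int_{t_{j-1}}^{t_j}\frac{2s-t_{j-1}-t_j}{\tau_{j+1}(\tau_j+\tau_{j+1})}\sum_{\ell=1}^{N_q}\varpi^\ell e^{-\theta^\ell(t_k^*-s)}\,ds,$$ $\hat c_0^{(k)}=0$, and $\hat d_j^{(k)}=\hat c_{j-1}^{(k)}-\hat a_j^{(k)}$. Fast L2-1$_\sigma$ operator ($k\ge1$), approximating $\partial_t^\alpha u(t_k^* )$: $$F_k^{\alpha,*}u=\frac1{\Gamma(1-\alpha)}\Big(\hat c_{k-1}^{(k)}\delta_ku+\sum_{j=1}^{k-1}\hat d_j^{(k)}\delta_ju\Big)+\frac{\sigma^{1-\alpha}}{\Gamma(2-\alpha)\tau_k^\alpha}\delta_ku.$$ *)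

theory Defs
  imports "HOL-Analysis.Analysis"
begin

section \<open>Bounded Lipschitz domains\<close>

text \<open>Near every boundary point the domain is, in suitable Cartesian coordinates with
  last axis \<open>e\<close>, the strict epigraph of a Lipschitz function \<open>\<gamma>\<close> of the remaining coordinates;
  these are represented by the orthogonal projection onto the hyperplane orthogonal to \<open>e\<close>.\<close>

definition bounded_lipschitz_domain :: "'a::euclidean_space set \<Rightarrow> bool" where
  "bounded_lipschitz_domain \<Omega> \<longleftrightarrow>
     open \<Omega> \<and> connected \<Omega> \<and> \<Omega> \<noteq> {} \<and> bounded \<Omega> \<and>
     (\<forall>x\<in>frontier \<Omega>. \<exists>r>0. \<exists>e. \<exists>\<gamma> :: 'a \<Rightarrow> real. \<exists>C.
        norm e = 1 \<and> C-lipschitz_on {y. y \<bullet> e = 0} \<gamma> \<and>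
        \<Omega> \<inter> ball x r = {y \<in> ball x r. \<gamma> (y - (y \<bullet> e) *\<^sub>R e) < y \<bullet> e})"

section \<open>Sobolev spaces\<close>

primrec times_differentiable :: "nat \<Rightarrow> ('a::euclidean_space \<Rightarrow> real) \<Rightarrow> bool" where
  "times_differentiable 0 \<phi> \<longleftrightarrow> True"
| "times_differentiable (Suc m) \<phi> \<longleftrightarrow>
     (\<forall>x. \<phi> differentiable (at x)) \<and>
     (\<forall>b\<in>Basis. times_differentiable m (\<lambda>x. frechet_derivative \<phi> (at x) b))"

definition test_function :: "'a::euclidean_space set \<Rightarrow> ('a \<Rightarrow> real) \<Rightarrow> bool" where
  "test_function \<Omega> \<phi> \<longleftrightarrow>
     (\<forall>m. times_differentiable m \<phi>) \<and>
     compact (closure {x. \<phi> x \<noteq> 0}) \<and> closure {x. \<phi> x \<noteq> 0} \<subseteq> \<Omega>"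

definition grad :: "('a::euclidean_space \<Rightarrow> real) \<Rightarrow> 'a \<Rightarrow> 'a" where
  "grad \<phi> x = (\<Sum>b\<in>Basis. frechet_derivative \<phi> (at x) b *\<^sub>R b)"

definition locally_integrable ::
    "'a::euclidean_space set \<Rightarrow> ('a \<Rightarrow> 'b::euclidean_space) \<Rightarrow> bool" where
  "locally_integrable \<Omega> g \<longleftrightarrow> (\<forall>K. compact K \<and> K \<subseteq> \<Omega> \<longrightarrow> integrable (lebesgue_on K) g)"

definition weak_gradient ::
    "'a::euclidean_space set \<Rightarrow> ('a \<Rightarrow> real) \<Rightarrow> ('a \<Rightarrow> 'a) \<Rightarrow> bool" where
  "weak_gradient \<Omega> v Dv \<longleftrightarrow>
     locally_integrable \<Omega> v \<and> locally_integrable \<Omega> Dv \<and>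
     (\<forall>\<phi>. test_function \<Omega> \<phi> \<longrightarrow> (\<forall>b\<in>Basis.
        (\<integral>x. v x * (grad \<phi> x \<bullet> b) \<partial>lebesgue_on \<Omega>) =
        - (\<integral>x. (Dv x \<bullet> b) * \<phi> x \<partial>lebesgue_on \<Omega>)))"

text \<open>Elements of the Sobolev spaces below are pairs of a function and a representative of
  its weak gradient, which is only determined up to null sets.\<close>

definition H1 :: "'a::euclidean_space set \<Rightarrow> (('a \<Rightarrow> real) \<times> ('a \<Rightarrow> 'a)) set" where
  "H1 \<Omega> = {(v, Dv). weak_gradient \<Omega> v Dv \<and>
     v \<in> borel_measurable (lebesgue_on \<Omega>) \<and> integrable (lebesgue_on \<Omega>) (\<lambda>x. (v x)\<^sup>2) \<and>
     Dv \<in> borel_measurable (lebesgue_on \<Omega>) \<and> integrable (lebesgue_on \<Omega>) (\<lambda>x. (norm (Dv x))\<^sup>2)}"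

text \<open>The closure of the test functions in \<open>H1 \<Omega>\<close>, i.e. the functions with zero trace.\<close>

definition H1_zero :: "'a::euclidean_space set \<Rightarrow> (('a \<Rightarrow> real) \<times> ('a \<Rightarrow> 'a)) set" where
  "H1_zero \<Omega> = {(v, Dv). (v, Dv) \<in> H1 \<Omega> \<and>
     (\<exists>\<phi> :: nat \<Rightarrow> 'a \<Rightarrow> real. (\<forall>m. test_function \<Omega> (\<phi> m)) \<and>
       (\<lambda>m. \<integral>x. (\<phi> m x - v x)\<^sup>2 + (norm (grad (\<phi> m) x - Dv x))\<^sup>2 \<partial>lebesgue_on \<Omega>)
         \<longlonglongrightarrow> 0)}"

text \<open>\<open>\<Omega>\<close> is a cell of the lattice generated by the basis \<open>P\<close>: its lattice translates tile the
  space up to a null set. The usual case is a box \<open>box a b\<close> with \<open>P\<close> the set of its edge vectors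
  \<open>((b - a) \<bullet> i) *\<^sub>R i\<close> for \<open>i \<in> Basis\<close>.\<close>

definition lattice :: "'a::euclidean_space set \<Rightarrow> 'a set" where
  "lattice P = {(\<Sum>p\<in>P. of_int (c p) *\<^sub>R p) | c :: 'a \<Rightarrow> int. True}"

definition period_cell :: "'a::euclidean_space set \<Rightarrow> 'a set \<Rightarrow> bool" where
  "period_cell P \<Omega> \<longleftrightarrow>
     independent P \<and> span P = UNIV \<and>
     (\<forall>p\<in>lattice P. p \<noteq> 0 \<longrightarrow> \<Omega> \<inter> (\<lambda>x. x + p) ` \<Omega> = {}) \<and>
     negligible (UNIV - (\<Union>p\<in>lattice P. (\<lambda>x. x + p) ` \<Omega>))"

text \<open>The functions whose periodic extension is weakly differentiable on the whole space,
  i.e. whose traces match across the boundary.\<close>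

definition H1_periodic ::
    "'a::euclidean_space set \<Rightarrow> 'a set \<Rightarrow> (('a \<Rightarrow> real) \<times> ('a \<Rightarrow> 'a)) set" where
  "H1_periodic P \<Omega> = {(v, Dv). (v, Dv) \<in> H1 \<Omega> \<and>
     (\<exists>w Dw. weak_gradient UNIV w Dw \<and> (\<forall>p\<in>P. \<forall>x. w (x + p) = w x) \<and>
        (\<forall>x\<in>\<Omega>. w x = v x \<and> Dw x = Dv x))}"

text \<open>The Laplacian as a functional on the space of test pairs belonging to the boundary condition.
  If \<open>u\<close> has a square-integrable Laplacian and satisfies the boundary condition, then by
  Green's formula this is the integral of \<open>\<Delta>u * v\<close>. For Neumann conditions
  the test space is all of \<open>H1 \<Omega>\<close>, so that the condition on the normal
  derivative is the natural boundary condition contained in the equation.\<close>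

definition laplacian ::
    "'a::euclidean_space set \<Rightarrow> (('a \<Rightarrow> real) \<times> ('a \<Rightarrow> 'a)) \<Rightarrow> (('a \<Rightarrow> real) \<times> ('a \<Rightarrow> 'a)) \<Rightarrow> real" where
  "laplacian \<Omega> u v = - (\<integral>x. snd u x \<bullet> snd v x \<partial>lebesgue_on \<Omega>)"

section \<open>The fast L2-1-sigma operator\<close>

definition soe_approximation ::
    "real \<Rightarrow> real \<Rightarrow> real \<Rightarrow> real \<Rightarrow> nat \<Rightarrow> (nat \<Rightarrow> real) \<Rightarrow> (nat \<Rightarrow> real) \<Rightarrow> bool" where
  "soe_approximation \<alpha> \<epsilon> \<Delta>t Tsoe Nq \<theta> \<omega> \<longleftrightarrow>
     0 < Nq \<and> (\<forall>l\<in>{1..Nq}. 0 < \<theta> l \<and> 0 < \<omega> l) \<and>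
     (\<forall>s\<in>{\<Delta>t..Tsoe}. \<bar>s powr (-\<alpha>) - (\<Sum>l=1..Nq. \<omega> l * exp (- \<theta> l * s))\<bar> \<le> \<epsilon>)"

definition tau :: "(nat \<Rightarrow> real) \<Rightarrow> nat \<Rightarrow> real" where
  "tau t k = t k - t (k - 1)"

definition tstar :: "real \<Rightarrow> (nat \<Rightarrow> real) \<Rightarrow> nat \<Rightarrow> real" where
  "tstar \<sigma> t k = t (k - 1) + \<sigma> * tau t k"

definition delta :: "(nat \<Rightarrow> real) \<Rightarrow> nat \<Rightarrow> real" where
  "delta u k = u k - u (k - 1)"

context
  fixes \<sigma> :: real and Nq :: nat and \<theta> \<omega> :: "nat \<Rightarrow> real" and t :: "nat \<Rightarrow> real"
begin

definition a_hat :: "nat \<Rightarrow> nat \<Rightarrow> real" where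
  "a_hat k j = integral {t (j - 1)..t j}
     (\<lambda>s. (2 * s - t j - t (j + 1)) / (tau t j * (tau t j + tau t (j + 1))) *
          (\<Sum>l=1..Nq. \<omega> l * exp (- \<theta> l * (tstar \<sigma> t k - s))))"

definition c_hat :: "nat \<Rightarrow> nat \<Rightarrow> real" where
  "c_hat k j = (if j = 0 then 0 else integral {t (j - 1)..t j}
     (\<lambda>s. (2 * s - t (j - 1) - t j) / (tau t (j + 1) * (tau t j + tau t (j + 1))) *
          (\<Sum>l=1..Nq. \<omega> l * exp (- \<theta> l * (tstar \<sigma> t k - s)))))"

definition d_hat :: "nat \<Rightarrow> nat \<Rightarrow> real" where
  "d_hat k j = c_hat k (j - 1) - a_hat k j"

end

definition fast_L21sigma ::
    "real \<Rightarrow> real \<Rightarrow> nat \<Rightarrow> (nat \<Rightarrow> real) \<Rightarrow> (nat \<Rightarrow> real) \<Rightarrow> (nat \<Rightarrow> real) \<Rightarrow> nat \<Rightarrow> (nat \<Rightarrow> real) \<Rightarrow> real" where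
  "fast_L21sigma \<alpha> \<sigma> Nq \<theta> \<omega> t k u =
     1 / Gamma (1 - \<alpha>) *
       (c_hat \<sigma> Nq \<theta> \<omega> t k (k - 1) * delta u k +
        (\<Sum>j=1..k-1. d_hat \<sigma> Nq \<theta> \<omega> t k j * delta u j)) +
     \<sigma> powr (1 - \<alpha>) / (Gamma (2 - \<alpha>) * tau t k powr \<alpha>) * delta u k"

definition energy ::
    "'a::euclidean_space set \<Rightarrow> real \<Rightarrow> (real \<Rightarrow> real) \<Rightarrow> (('a \<Rightarrow> real) \<times> ('a \<Rightarrow> 'a)) \<Rightarrow> real" where
  "energy \<Omega> \<nu> F u = (\<integral>x. \<nu>\<^sup>2 / 2 * (norm (snd u x))\<^sup>2 + F (fst u x) \<partial>lebesgue_on \<Omega>)"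

end

theory Submission
  imports Defs
begin

text \<open>The scheme at level \<open>k\<close> is tested with the increment \<open>\<delta>\<close> of the numerical solution from level
  \<open>k - 1\<close> to level \<open>k\<close>. Since \<open>\<sigma> \<ge> 1/2\<close>, the weighted Laplacian dissipates at least the increment of
  the Dirichlet energy, and Taylor's formula with \<open>\<bar>f'\<bar> \<le> L\<close> bounds the increment of the potential
  by the linearised reaction term up to \<open>(3 - \<alpha>) / 2 * L * \<delta>\<^sup>2\<close> (lemma \<open>energy_step\<close>). Summing
  over \<open>k\<close>, the energy can only have grown by
  \<open>\<integral> \<Sum>\<^sub>k ((3 - \<alpha>) / 2 * L * \<delta>\<^sub>k\<^sup>2 - F\<^sub>k u * \<delta>\<^sub>k)\<close>. The theorem therefore reduces to a pointwise
  statement about real sequences: the lower triangular quadratic form of the fast operator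
  dominates a multiple of the sum of squares (lemma \<open>fast_L21sigma_coercive\<close>).

  Write \<open>d k j\<close> and \<open>c k j\<close> for the history coefficients of level \<open>k\<close>. If the off-diagonal
  entries \<open>d k j\<close> of a symmetric matrix increase in \<open>j\<close>, with increments that decrease in \<open>k\<close>, then
  the matrix is a nonnegative combination of the rank-one matrices belonging to indicator vectors of
  intervals, as soon as each diagonal entry reaches
  \<open>d k (k - 1) + d (k + 1) k - d (k + 1) (k - 1)\<close> (lemma \<open>quadratic_form_nonneg\<close>). Two facts about
  the coefficients remain.

  First, the two monotonicity properties. The coefficients are
  linear in the function \<open>g s = K (t\<^sub>k\<^sup>* - s)\<close>, where \<open>K\<close> is the sum of exponentials. This \<open>g\<close> is
  increasing and convex, and so is the difference of the functions \<open>g\<close> of two successive levels,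
  because each exponential only changes its weight. Hence both properties are one
  inequality for increasing convex functions (lemma \<open>history_weight_le_Suc\<close>), in which
  the mesh condition \<open>3 * \<rho>\<^sup>2 * (1 + \<rho>) \<ge> 1\<close> absorbs the one negative term.

  Second, for \<open>k \<ge> 2\<close> the diagonal excess
  \<open>d k (k - 1) + d (k + 1) k - d (k + 1) (k - 1) - 2 * c k (k - 1)\<close> is at most
  \<open>K (\<sigma> * \<tau>\<^sub>k) + K (\<sigma> * \<tau>') - K (\<sigma> * \<tau>' + \<tau>\<^sub>k)\<close>, where \<open>\<tau>'\<close> is the step that follows \<open>\<tau>\<^sub>k\<close>
  (lemma \<open>soe_history_weight_bounds\<close>). The three values of \<open>K\<close> are taken in the range of the
  approximation and cost \<open>3 * \<epsilon>\<close>; the step size restriction is the resulting inequality between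
  powers, solved for \<open>\<tau>\<^sub>k\<close>. For \<open>k = 1\<close> the single value \<open>K (\<sigma> * \<tau>')\<close> suffices.\<close>

section \<open>A criterion for nonnegative quadratic forms\<close>

text \<open>The assumptions say that the mixed differences of \<open>b\<close> below the diagonal are nonnegative.
  Symmetrised, the matrix is then a nonnegative combination of the rank-one matrices of indicator
  vectors of intervals \<open>{q..p}\<close> with \<open>q < p\<close>, and the factor in front of \<open>(y k)\<^sup>2\<close> is at least what
  these intervals put on the diagonal. The induction keeps the part that is still needed later:
  a weighted sum of squares of the tails \<open>y q + \<dots> + y (n - 1)\<close>.\<close>

lemma quadratic_form_nonneg:
  fixes b :: "nat \<Rightarrow> nat \<Rightarrow> real" and y :: "nat \<Rightarrow> real"
  assumes zero: "\<And>k. b k 0 = 0"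
    and incr: "\<And>k j. Suc j < k \<Longrightarrow> b k j \<le> b k (Suc j)"
    and decr: "\<And>k j. Suc j < k \<Longrightarrow> b (Suc k) (Suc j) - b (Suc k) j \<le> b k (Suc j) - b k j"
  shows "0 \<le> (\<Sum>k<n. 2 * y k * (\<Sum>j<k. b (Suc k) (Suc j) * y j)
      + (b (Suc k) k + b (Suc (Suc k)) (Suc k) - b (Suc (Suc k)) k) * (y k)\<^sup>2)"
proof -
  define Q where "Q n = (\<Sum>k<n. 2 * y k * (\<Sum>j<k. b (Suc k) (Suc j) * y j)
      + (b (Suc k) k + b (Suc (Suc k)) (Suc k) - b (Suc (Suc k)) k) * (y k)\<^sup>2)" for n
  define \<Phi> where "\<Phi> n = (\<Sum>q<n. (b (Suc n) (Suc q) - b (Suc n) q) * (\<Sum>i=q..<n. y i)\<^sup>2)" for n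
  \<comment> \<open>Summation by parts turns the coefficients of \<open>y\<close> into coefficients of the tails.\<close>
  have parts: "(\<Sum>q<m. (\<beta> (Suc q) - \<beta> q) * (\<Sum>i=q..<m. y i)) = (\<Sum>j<m. \<beta> (Suc j) * y j)"
    if "\<beta> 0 = 0" for \<beta> :: "nat \<Rightarrow> real" and m
  proof (induction m)
    case (Suc m)
    have "(\<Sum>q<Suc m. (\<beta> (Suc q) - \<beta> q) * (\<Sum>i=q..<Suc m. y i))
        = (\<Sum>q<Suc m. (\<beta> (Suc q) - \<beta> q) * (\<Sum>i=q..<m. y i) + (\<beta> (Suc q) - \<beta> q) * y m)"
      by (intro sum.cong) (auto simp: algebra_simps)
    also have "\<dots> = (\<Sum>q<m. (\<beta> (Suc q) - \<beta> q) * (\<Sum>i=q..<m. y i))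
        + (\<Sum>q<Suc m. \<beta> (Suc q) - \<beta> q) * y m"
      by (simp only: sum.distrib sum_distrib_right lessThan_Suc) simp
    also have "(\<Sum>q<Suc m. \<beta> (Suc q) - \<beta> q) = \<beta> (Suc m)"
      by (subst sum_lessThan_telescope) (simp add: that)
    finally show ?case using Suc by simp
  qed simp
  have "\<Phi> n \<le> Q n" for n
  proof (induction n)
    case 0 show ?case by (simp add: \<Phi>_def Q_def)
  next
    case (Suc n)
    define S where "S q = (\<Sum>i=q..<n. y i)" for q
    have "\<Phi> (Suc n) = (\<Sum>q<n. (b (Suc (Suc n)) (Suc q) - b (Suc (Suc n)) q) * (S q + y n)\<^sup>2)
        + (b (Suc (Suc n)) (Suc n) - b (Suc (Suc n)) n) * (y n)\<^sup>2"
      by (simp add: \<Phi>_def S_def)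
    also have "(\<Sum>q<n. (b (Suc (Suc n)) (Suc q) - b (Suc (Suc n)) q) * (S q + y n)\<^sup>2)
        \<le> (\<Sum>q<n. (b (Suc n) (Suc q) - b (Suc n) q) * (S q + y n)\<^sup>2)"
      by (intro sum_mono mult_right_mono decr) auto
    also have "\<dots> = \<Phi> n + 2 * y n * (\<Sum>q<n. (b (Suc n) (Suc q) - b (Suc n) q) * S q)
        + (\<Sum>q<n. b (Suc n) (Suc q) - b (Suc n) q) * (y n)\<^sup>2"
      unfolding \<Phi>_def S_def
      by (simp only: power2_sum distrib_left sum.distrib sum_distrib_left sum_distrib_right ac_simps)
    also have "(\<Sum>q<n. b (Suc n) (Suc q) - b (Suc n) q) = b (Suc n) n"
      by (subst sum_lessThan_telescope) (simp add: zero)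
    also have "(\<Sum>q<n. (b (Suc n) (Suc q) - b (Suc n) q) * S q) = (\<Sum>j<n. b (Suc n) (Suc j) * y j)"
      unfolding S_def by (rule parts) (rule zero)
    finally show ?case using Suc.IH by (simp add: Q_def algebra_simps)
  qed
  moreover have "0 \<le> \<Phi> n"
    unfolding \<Phi>_def by (intro sum_nonneg mult_nonneg_nonneg) (use incr in auto)
  ultimately show ?thesis unfolding Q_def by (meson order_trans)
qed

section \<open>Means and moments of increasing convex functions on a mesh\<close>

text \<open>The derivative is an explicit argument because all estimates compare values of the slope at
  mesh points. Everywhere increasing and convex is enough for the history kernels, which are
  exponential sums in the time variable.\<close>

definition convex_increasing :: "(real \<Rightarrow> real) \<Rightarrow> (real \<Rightarrow> real) \<Rightarrow> bool" where
  "convex_increasing g g' \<longleftrightarrow>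
     (\<forall>x. (g has_real_derivative g' x) (at x)) \<and> continuous_on UNIV g' \<and> mono g' \<and> (\<forall>x. 0 \<le> g' x)"

lemma convex_increasing_continuous:
  assumes "convex_increasing g g'" shows "continuous_on S g"
  using assms unfolding convex_increasing_def
  by (meson DERIV_isCont continuous_at_imp_continuous_on)

lemma convex_increasing_continuous_deriv:
  assumes "convex_increasing g g'" shows "continuous_on S g'"
  using assms unfolding convex_increasing_def by (meson continuous_on_subset subset_UNIV)

lemma integrate_by_parts_vs_slope:
  assumes g: "convex_increasing g g'" and "a \<le> b"
    and p: "\<And>x. (p has_real_derivative p' x) (at x)" and p': "continuous_on {a..b} p'"
  shows "integral {a..b} (\<lambda>s. p s * g' s) = p b * g b - p a * g a - integral {a..b} (\<lambda>s. p' s * g s)"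
proof -
  have cp: "continuous_on {a..b} p" using p by (meson DERIV_isCont continuous_at_imp_continuous_on)
  have "((\<lambda>s. p' s * g s + p s * g' s) has_integral p b * g b - p a * g a) {a..b}"
  proof (rule fundamental_theorem_of_calculus[OF \<open>a \<le> b\<close>])
    fix x
    have "((\<lambda>s. p s * g s) has_real_derivative (p' x * g x + p x * g' x)) (at x)"
      using g p by (auto intro!: derivative_eq_intros simp: convex_increasing_def)
    then show "((\<lambda>s. p s * g s) has_vector_derivative p' x * g x + p x * g' x) (at x within {a..b})"
      by (simp add: has_real_derivative_iff_has_vector_derivative has_vector_derivative_at_within)
  qed
  then have "p b * g b - p a * g a = integral {a..b} (\<lambda>s. p' s * g s + p s * g' s)"
    by (simp add: integral_unique)
  also have "\<dots> = integral {a..b} (\<lambda>s. p' s * g s) + integral {a..b} (\<lambda>s. p s * g' s)"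
    by (intro integral_add integrable_continuous_interval continuous_intros cp p'
        convex_increasing_continuous[OF g] convex_increasing_continuous_deriv[OF g])
  finally show ?thesis by simp
qed

text \<open>The coefficients of the operator depend on \<open>g\<close> only through its cell means and its first
  moments about the cell midpoints. Since \<open>t (0 - 1) = t 0\<close>, the cell with index \<open>0\<close> is a single
  point, and the convention that the coefficient with index \<open>0\<close> vanishes needs no case
  distinction below.\<close>

definition cell_mean :: "(nat \<Rightarrow> real) \<Rightarrow> (real \<Rightarrow> real) \<Rightarrow> nat \<Rightarrow> real" where
  "cell_mean t g j = integral {t (j - 1)..t j} g / tau t j"

definition cell_moment :: "(nat \<Rightarrow> real) \<Rightarrow> (real \<Rightarrow> real) \<Rightarrow> nat \<Rightarrow> real" where
  "cell_moment t g j = integral {t (j - 1)..t j} (\<lambda>s. (2 * s - t (j - 1) - t j) * g s)"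

lemma cell_moment_0 [simp]: "cell_moment t g 0 = 0"
  by (simp add: cell_moment_def)

lemma cell_mean_0 [simp]: "cell_mean t g 0 = 0"
  by (simp add: cell_mean_def tau_def)

lemma tau_pos:
  assumes "strict_mono t" "1 \<le> k" shows "0 < tau t k"
  using assms by (simp add: tau_def strict_mono_def)

context
  fixes t :: "nat \<Rightarrow> real" and g g' :: "real \<Rightarrow> real"
  assumes mesh: "strict_mono t" and g: "convex_increasing g g'"
begin

lemma mesh_le: "t (j - 1) \<le> t j"
  using mesh by (simp add: strict_mono_less_eq)

text \<open>The weight of the moment has a primitive that vanishes at both ends of the cell, so that
  integration by parts leaves the slope of \<open>g\<close> against a nonnegative bubble.\<close>

lemma cell_moment_slope:
  "cell_moment t g j = integral {t (j - 1)..t j} (\<lambda>s. ((s - t (j - 1)) * (t j - s)) * g' s)"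
proof -
  have "((\<lambda>s. (s - t (j - 1)) * (t j - s)) has_real_derivative - (2 * x - t (j - 1) - t j)) (at x)" for x
    by (auto intro!: derivative_eq_intros)
  from integrate_by_parts_vs_slope[OF g mesh_le[of j] this]
  have "integral {t (j - 1)..t j} (\<lambda>s. ((s - t (j - 1)) * (t j - s)) * g' s)
      = - integral {t (j - 1)..t j} (\<lambda>s. - (2 * s - t (j - 1) - t j) * g s)"
    by (simp add: continuous_intros)
  also have "\<dots> = cell_moment t g j"
    unfolding cell_moment_def mult_minus_left integral_neg by simp
  finally show ?thesis ..
qed

lemma cell_mean_slope_right:
  assumes "1 \<le> j"
  shows "tau t j * (g (t j) - cell_mean t g j) = integral {t (j - 1)..t j} (\<lambda>s. (s - t (j - 1)) * g' s)"
proof -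
  have "((\<lambda>s. s - t (j - 1)) has_real_derivative 1) (at x)" for x
    by (auto intro!: derivative_eq_intros)
  from integrate_by_parts_vs_slope[OF g mesh_le[of j] this]
  have "integral {t (j - 1)..t j} (\<lambda>s. (s - t (j - 1)) * g' s)
      = tau t j * g (t j) - integral {t (j - 1)..t j} g"
    by (simp add: tau_def)
  then show ?thesis using tau_pos[OF mesh assms] by (simp add: cell_mean_def right_diff_distrib)
qed

lemma cell_mean_slope_left:
  assumes "1 \<le> j"
  shows "tau t j * (cell_mean t g j - g (t (j - 1))) = integral {t (j - 1)..t j} (\<lambda>s. (t j - s) * g' s)"
proof -
  have "((\<lambda>s. t j - s) has_real_derivative -1) (at x)" for x
    by (auto intro!: derivative_eq_intros)
  from integrate_by_parts_vs_slope[OF g mesh_le[of j] this]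
  have "integral {t (j - 1)..t j} (\<lambda>s. (t j - s) * g' s)
      = integral {t (j - 1)..t j} g - tau t j * g (t (j - 1))"
    by (simp add: tau_def)
  then show ?thesis using tau_pos[OF mesh assms] by (simp add: cell_mean_def right_diff_distrib)
qed

lemma slope_integrable: "continuous_on {a..b} p \<Longrightarrow> (\<lambda>s. p s * g' s) integrable_on {a..b}"
  by (intro integrable_continuous_interval continuous_intros convex_increasing_continuous_deriv[OF g])

lemma cell_moment_nonneg: "0 \<le> cell_moment t g j"
  unfolding cell_moment_slope using g
  by (intro integral_nonneg slope_integrable)
     (auto intro!: continuous_intros mult_nonneg_nonneg simp: convex_increasing_def)

lemma cell_moment_le_slope: "cell_moment t g j \<le> g' (t j) * tau t j ^ 3 / 6"
proof -
  let ?a = "t (j - 1)" and ?b = "t j"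
  have "((\<lambda>s. (s - ?a) * (?b - s)) has_integral
      ((?a + ?b) * ?b\<^sup>2 / 2 - ?b ^ 3 / 3 - ?a * ?b * ?b) - ((?a + ?b) * ?a\<^sup>2 / 2 - ?a ^ 3 / 3 - ?a * ?b * ?a))
      {?a..?b}"
  proof (rule fundamental_theorem_of_calculus[OF mesh_le])
    fix x
    have "((\<lambda>x. (?a + ?b) * x\<^sup>2 / 2 - x ^ 3 / 3 - ?a * ?b * x) has_real_derivative (x - ?a) * (?b - x)) (at x)"
      by (auto intro!: derivative_eq_intros simp: algebra_simps power2_eq_square)
    then show "((\<lambda>x. (?a + ?b) * x\<^sup>2 / 2 - x ^ 3 / 3 - ?a * ?b * x) has_vector_derivative (x - ?a) * (?b - x))
        (at x within {?a..?b})"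
      by (simp add: has_real_derivative_iff_has_vector_derivative has_vector_derivative_at_within)
  qed
  then have "integral {?a..?b} (\<lambda>s. (s - ?a) * (?b - s)) =
      ((?a + ?b) * ?b\<^sup>2 / 2 - ?b ^ 3 / 3 - ?a * ?b * ?b) - ((?a + ?b) * ?a\<^sup>2 / 2 - ?a ^ 3 / 3 - ?a * ?b * ?a)"
    by (rule integral_unique)
  also have "\<dots> = (?b - ?a) ^ 3 / 6"
    by (simp add: field_simps power2_eq_square power3_eq_cube)
  finally have *: "integral {?a..?b} (\<lambda>s. (s - ?a) * (?b - s)) = tau t j ^ 3 / 6"
    by (simp only: tau_def)
  have "cell_moment t g j \<le> integral {?a..?b} (\<lambda>s. ((s - ?a) * (?b - s)) * g' ?b)"
    unfolding cell_moment_slope using g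
    by (intro integral_le slope_integrable mult_left_mono integrable_continuous_interval)
       (auto intro!: continuous_intros simp: convex_increasing_def mono_def)
  also have "\<dots> = g' ?b * tau t j ^ 3 / 6"
    unfolding integral_mult_left * by (simp add: mult.commute)
  finally show ?thesis .
qed

lemma slope_le_cell_mean_gap:
  assumes "1 \<le> j"
  shows "g' (t (j - 1)) * tau t j / 2 \<le> g (t j) - cell_mean t g j"
proof -
  let ?a = "t (j - 1)" and ?b = "t j"
  have "((\<lambda>s. s - ?a) has_integral ((?b - ?a)\<^sup>2 / 2 - (?a - ?a)\<^sup>2 / 2)) {?a..?b}"
  proof (rule fundamental_theorem_of_calculus[OF mesh_le])
    fix x
    have "((\<lambda>x. (x - ?a)\<^sup>2 / 2) has_real_derivative x - ?a) (at x)"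
      by (auto intro!: derivative_eq_intros)
    then show "((\<lambda>x. (x - ?a)\<^sup>2 / 2) has_vector_derivative x - ?a) (at x within {?a..?b})"
      by (simp add: has_real_derivative_iff_has_vector_derivative has_vector_derivative_at_within)
  qed
  then have *: "integral {?a..?b} (\<lambda>s. s - ?a) = (tau t j)\<^sup>2 / 2"
    unfolding tau_def by (subst integral_unique) auto
  have "(tau t j)\<^sup>2 / 2 * g' ?a = integral {?a..?b} (\<lambda>s. (s - ?a) * g' ?a)"
    by (simp only: * integral_mult_left)
  also have "\<dots> \<le> tau t j * (g ?b - cell_mean t g j)"
    unfolding cell_mean_slope_right[OF assms] using g
    by (intro integral_le slope_integrable mult_left_mono integrable_continuous_interval)
       (auto intro!: continuous_intros simp: convex_increasing_def mono_def)
  finally show ?thesis using tau_pos[OF mesh assms]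
    by (simp add: power2_eq_square mult.assoc mult.left_commute mult.commute)
qed

text \<open>Both sides are integrals of the slope, and the bubble \<open>(s - t (j - 1)) * (t j - s)\<close> lies below
  \<open>tau t j * (t j - s)\<close>.\<close>

lemma cell_moment_le_mean_gap:
  assumes "1 \<le> j"
  shows "cell_moment t g j \<le> (tau t j)\<^sup>2 * (cell_mean t g j - g (t (j - 1)))"
proof -
  let ?a = "t (j - 1)" and ?b = "t j"
  have "cell_moment t g j \<le> integral {?a..?b} (\<lambda>s. (tau t j * (?b - s)) * g' s)"
    unfolding cell_moment_slope using g
    by (intro integral_le slope_integrable mult_right_mono integrable_continuous_interval)
       (auto intro!: continuous_intros simp: convex_increasing_def tau_def)
  also have "\<dots> = tau t j * (tau t j * (cell_mean t g j - g ?a))"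
    unfolding cell_mean_slope_left[OF assms] by (simp add: mult.assoc)
  finally show ?thesis by (simp add: power2_eq_square mult.assoc)
qed

end

section \<open>The coefficients as functionals of the history kernel\<close>

text \<open>For \<open>g s = K (tstar \<sigma> t k - s)\<close> these two functionals are the coefficients \<open>c_hat\<close> and
  \<open>d_hat\<close> of level \<open>k\<close>. They are separated from the kernel because they are linear in \<open>g\<close>: a
  difference of coefficients of two levels is a coefficient of the difference of the kernels.\<close>

definition moment_weight :: "(nat \<Rightarrow> real) \<Rightarrow> (real \<Rightarrow> real) \<Rightarrow> nat \<Rightarrow> real" where
  "moment_weight t g j = cell_moment t g j / (tau t (j + 1) * (tau t j + tau t (j + 1)))"

definition history_weight :: "(nat \<Rightarrow> real) \<Rightarrow> (real \<Rightarrow> real) \<Rightarrow> nat \<Rightarrow> real" where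
  "history_weight t g j = cell_mean t g j + moment_weight t g (j - 1)
     - cell_moment t g j / (tau t j * (tau t j + tau t (j + 1)))"

lemma history_weight_0 [simp]: "history_weight t g 0 = 0"
  by (simp add: history_weight_def moment_weight_def)

lemma cell_moment_diff:
  assumes "continuous_on UNIV g" "continuous_on UNIV h"
  shows "cell_moment t (\<lambda>s. g s - h s) j = cell_moment t g j - cell_moment t h j"
  unfolding cell_moment_def right_diff_distrib
  by (intro integral_diff integrable_continuous_interval continuous_intros
      continuous_on_subset[OF assms(1)] continuous_on_subset[OF assms(2)]) auto

lemma cell_mean_diff:
  assumes "continuous_on UNIV g" "continuous_on UNIV h"
  shows "cell_mean t (\<lambda>s. g s - h s) j = cell_mean t g j - cell_mean t h j"
  unfolding cell_mean_def
  by (subst integral_diff)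
     (auto intro!: integrable_continuous_interval
       intro: continuous_on_subset[OF assms(1)] continuous_on_subset[OF assms(2)] simp: diff_divide_distrib)

lemma moment_weight_diff:
  assumes "continuous_on UNIV g" "continuous_on UNIV h"
  shows "moment_weight t (\<lambda>s. g s - h s) j = moment_weight t g j - moment_weight t h j"
  by (simp add: moment_weight_def cell_moment_diff[OF assms] diff_divide_distrib)

lemma history_weight_diff:
  assumes "continuous_on UNIV g" "continuous_on UNIV h"
  shows "history_weight t (\<lambda>s. g s - h s) j = history_weight t g j - history_weight t h j"
  by (simp add: history_weight_def cell_mean_diff[OF assms] cell_moment_diff[OF assms]
      moment_weight_diff[OF assms] diff_divide_distrib)

definition soe_kernel :: "nat \<Rightarrow> (nat \<Rightarrow> real) \<Rightarrow> (nat \<Rightarrow> real) \<Rightarrow> real \<Rightarrow> real" where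
  "soe_kernel Nq \<theta> \<omega> s = (\<Sum>l=1..Nq. \<omega> l * exp (- \<theta> l * s))"

lemma c_hat_eq:
  "c_hat \<sigma> Nq \<theta> \<omega> t k j = moment_weight t (\<lambda>s. soe_kernel Nq \<theta> \<omega> (tstar \<sigma> t k - s)) j"
proof (cases "j = 0")
  case False
  have "c_hat \<sigma> Nq \<theta> \<omega> t k j = integral {t (j - 1)..t j} (\<lambda>s. 1 / (tau t (j + 1) * (tau t j + tau t (j + 1))) *
      ((2 * s - t (j - 1) - t j) * soe_kernel Nq \<theta> \<omega> (tstar \<sigma> t k - s)))"
    using False by (simp add: c_hat_def soe_kernel_def)
  then show ?thesis by (simp add: moment_weight_def cell_moment_def)
qed (simp add: c_hat_def moment_weight_def)

text \<open>The weight of \<open>a_hat\<close> is centred at the midpoint of the next cell; recentring it at the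
  midpoint of cell \<open>j\<close> costs exactly one cell mean.\<close>

lemma d_hat_eq:
  assumes mesh: "strict_mono t"
  shows "d_hat \<sigma> Nq \<theta> \<omega> t k j = history_weight t (\<lambda>s. soe_kernel Nq \<theta> \<omega> (tstar \<sigma> t k - s)) j"
proof (cases "j = 0")
  case False
  define g where "g s = soe_kernel Nq \<theta> \<omega> (tstar \<sigma> t k - s)" for s
  have cont: "continuous_on S g" for S
    unfolding g_def soe_kernel_def by (intro continuous_intros)
  have \<tau>: "0 < tau t j" "0 < tau t (j + 1)" using tau_pos[OF mesh] False by auto
  have w: "(2 * s - t j - t (j + 1)) / (tau t j * (tau t j + tau t (j + 1)))
      = (2 * s - t (j - 1) - t j) / (tau t j * (tau t j + tau t (j + 1))) - 1 / tau t j" for s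
  proof -
    have *: "2 * s - t j - t (j + 1) = (2 * s - t (j - 1) - t j) - (tau t j + tau t (j + 1))"
      by (simp add: tau_def)
    show ?thesis unfolding * using \<tau> by (subst diff_divide_distrib) simp
  qed
  have "a_hat \<sigma> Nq \<theta> \<omega> t k j = integral {t (j - 1)..t j} (\<lambda>s.
      1 / (tau t j * (tau t j + tau t (j + 1))) * ((2 * s - t (j - 1) - t j) * g s) - 1 / tau t j * g s)"
    unfolding a_hat_def soe_kernel_def[symmetric] g_def[symmetric] w by (simp add: left_diff_distrib)
  also have "\<dots> = cell_moment t g j / (tau t j * (tau t j + tau t (j + 1))) - cell_mean t g j"
    by (subst integral_diff)
       (use \<tau> in \<open>auto intro!: integrable_continuous_interval continuous_intros cont
         simp: cell_moment_def cell_mean_def\<close>)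
  finally show ?thesis using False
    by (simp add: d_hat_def c_hat_eq history_weight_def g_def[symmetric])
qed (simp add: d_hat_def c_hat_def a_hat_def)

lemma convex_increasing_soe_kernel:
  assumes "\<forall>l\<in>{1..Nq}. 0 \<le> \<theta> l \<and> 0 \<le> \<omega> l"
  shows "convex_increasing (\<lambda>s. soe_kernel Nq \<theta> \<omega> (T - s)) (\<lambda>s. \<Sum>l=1..Nq. \<omega> l * \<theta> l * exp (- \<theta> l * (T - s)))"
  unfolding convex_increasing_def soe_kernel_def
proof (intro conjI allI)
  show "((\<lambda>s. \<Sum>l=1..Nq. \<omega> l * exp (- \<theta> l * (T - s))) has_real_derivative
      (\<Sum>l=1..Nq. \<omega> l * \<theta> l * exp (- \<theta> l * (T - x)))) (at x)" for x
    by (auto intro!: derivative_eq_intros DERIV_sum sum.cong)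
  show "mono (\<lambda>s. \<Sum>l=1..Nq. \<omega> l * \<theta> l * exp (- \<theta> l * (T - s)))"
    using assms by (intro monoI sum_mono mult_left_mono) (auto intro: mult_left_mono)
  show "0 \<le> (\<Sum>l=1..Nq. \<omega> l * \<theta> l * exp (- \<theta> l * (T - x)))" for x
    using assms by (intro sum_nonneg mult_nonneg_nonneg) (auto simp: less_imp_le)
qed (intro continuous_intros)

text \<open>Delaying the kernel multiplies each weight by an exponential, so the loss is again a sum of
  exponentials with nonnegative weights and inherits every property of such sums.\<close>

lemma soe_kernel_diff:
  "soe_kernel Nq \<theta> \<omega> s - soe_kernel Nq \<theta> \<omega> (s + h)
     = soe_kernel Nq \<theta> (\<lambda>l. \<omega> l * (1 - exp (- \<theta> l * h))) s"
  unfolding soe_kernel_def sum_subtractf[symmetric]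
  by (intro sum.cong) (auto simp: algebra_simps exp_add[symmetric])

lemma soe_kernel_antimono:
  assumes "\<forall>l\<in>{1..Nq}. 0 \<le> \<theta> l \<and> 0 \<le> \<omega> l" "r \<le> s"
  shows "soe_kernel Nq \<theta> \<omega> s \<le> soe_kernel Nq \<theta> \<omega> r"
  unfolding soe_kernel_def using assms by (intro sum_mono mult_left_mono) (auto simp: mult_left_mono)

lemma convex_increasing_soe_kernel_diff:
  assumes "\<forall>l\<in>{1..Nq}. 0 \<le> \<theta> l \<and> 0 \<le> \<omega> l" and "T \<le> T'"
  shows "\<exists>g'. convex_increasing (\<lambda>s. soe_kernel Nq \<theta> \<omega> (T - s) - soe_kernel Nq \<theta> \<omega> (T' - s)) g'"
proof -
  have *: "soe_kernel Nq \<theta> \<omega> (T - s) - soe_kernel Nq \<theta> \<omega> (T' - s)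
      = soe_kernel Nq \<theta> (\<lambda>l. \<omega> l * (1 - exp (- \<theta> l * (T' - T)))) (T - s)" for s
    using soe_kernel_diff[of Nq \<theta> \<omega> "T - s" "T' - T"] by simp
  have "\<forall>l\<in>{1..Nq}. 0 \<le> \<theta> l \<and> 0 \<le> \<omega> l * (1 - exp (- \<theta> l * (T' - T)))"
    using assms by auto
  from convex_increasing_soe_kernel[OF this, of T] show ?thesis unfolding * by blast
qed

section \<open>Monotonicity of the history coefficients\<close>

text \<open>This is the estimate that needs the mesh ratio. The left side is at most
  \<open>g' (t j) * \<tau>\<^sub>j ^ 3 / (6 * \<tau>\<^sub>j\<^sub>+\<^sub>1 * (\<tau>\<^sub>j + \<tau>\<^sub>j\<^sub>+\<^sub>1))\<close>, the right side at least
  \<open>g' (t j) * \<tau>\<^sub>j\<^sub>+\<^sub>1 / 2\<close>, and with \<open>\<rho> = \<tau>\<^sub>j\<^sub>+\<^sub>1 / \<tau>\<^sub>j\<close> the comparison of the two factors reads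
  \<open>1 \<le> 3 * \<rho>\<^sup>2 * (1 + \<rho>)\<close>.\<close>

lemma moment_weight_le_next_gap:
  assumes mesh: "strict_mono t" and g: "convex_increasing g g'"
    and \<eta>: "0 < \<eta>" "1 \<le> 3 * \<eta>\<^sup>2 * (1 + \<eta>)"
    and ratio: "\<And>k. 2 \<le> k \<Longrightarrow> \<eta> \<le> tau t k / tau t (k - 1)"
  shows "moment_weight t g j \<le> g (t (j + 1)) - cell_mean t g (j + 1)"
proof (cases "j = 0")
  case True
  have "0 \<le> g' (t 0) * tau t 1 / 2"
    using g tau_pos[OF mesh, of 1] by (simp add: convex_increasing_def)
  with slope_le_cell_mean_gap[OF mesh g, of 1] True show ?thesis
    by (simp add: moment_weight_def)
next
  case False
  define p q where "p = tau t j" and "q = tau t (j + 1)"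
  have pos: "0 < p" "0 < q" using False tau_pos[OF mesh] by (auto simp: p_def q_def)
  have "\<eta> \<le> q / p" using ratio[of "j + 1"] False by (simp add: p_def q_def)
  then have "\<eta>\<^sup>2 * (1 + \<eta>) \<le> (q / p)\<^sup>2 * (1 + q / p)"
    using \<eta> pos by (intro mult_mono power_mono) auto
  also have "\<dots> = q\<^sup>2 * (p + q) / p ^ 3"
    using pos by (simp add: field_simps power2_eq_square power3_eq_cube)
  finally have "1 \<le> 3 * (q\<^sup>2 * (p + q) / p ^ 3)" using \<eta> by linarith
  then have key: "p ^ 3 / 6 / (q * (p + q)) \<le> q / 2"
    using pos by (subst pos_divide_le_eq) (auto intro!: mult_pos_pos add_pos_pos simp: field_simps power2_eq_square)
  have "moment_weight t g j \<le> g' (t j) * p ^ 3 / 6 / (q * (p + q))"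
    using cell_moment_le_slope[OF mesh g, of j] pos
    unfolding moment_weight_def p_def[symmetric] q_def[symmetric]
    by (intro divide_right_mono) auto
  also have "\<dots> = g' (t j) * (p ^ 3 / 6 / (q * (p + q)))" by simp
  also have "\<dots> \<le> g' (t j) * (q / 2)"
    using g key by (intro mult_left_mono) (auto simp: convex_increasing_def)
  also have "\<dots> \<le> g (t (j + 1)) - cell_mean t g (j + 1)"
    using slope_le_cell_mean_gap[OF mesh g, of "j + 1"] by (simp add: q_def)
  finally show ?thesis .
qed

lemma moment_le_own_gap:
  assumes mesh: "strict_mono t" and g: "convex_increasing g g'" and j: "1 \<le> j"
  shows "cell_moment t g j / (tau t j * (tau t j + tau t (j + 1))) \<le> cell_mean t g j - g (t (j - 1))"
proof -
  have pos: "0 < tau t j" "0 < tau t (j + 1)" using j tau_pos[OF mesh] by auto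
  have "cell_moment t g j / (tau t j * (tau t j + tau t (j + 1))) \<le> cell_moment t g j / (tau t j * tau t j)"
    using pos cell_moment_nonneg[OF mesh g]
    by (intro divide_left_mono mult_left_mono) (auto intro!: mult_pos_pos)
  also have "\<dots> \<le> cell_mean t g j - g (t (j - 1))"
    using cell_moment_le_mean_gap[OF mesh g j] pos
    by (simp add: divide_le_eq power2_eq_square mult.commute)
  finally show ?thesis .
qed

lemma moment_weight_nonneg:
  assumes mesh: "strict_mono t" and g: "convex_increasing g g'"
  shows "0 \<le> moment_weight t g j"
proof -
  have "0 \<le> tau t j" "0 \<le> tau t (j + 1)"
    using mesh by (auto simp: tau_def strict_mono_less_eq)
  then show ?thesis unfolding moment_weight_def
    using cell_moment_nonneg[OF mesh g] by auto
qed

text \<open>The value of \<open>g\<close> at the common mesh point \<open>t j\<close> separates the two coefficients: the mean over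
  the cell to its right exceeds it by at least the moment subtracted there, and the mean over the
  cell to its left stays below it by at least the moment that cell \<open>j - 1\<close> contributes.\<close>

lemma history_weight_le_Suc:
  assumes mesh: "strict_mono t" and g: "convex_increasing g g'" and pos: "\<And>s. 0 \<le> g s"
    and \<eta>: "0 < \<eta>" "1 \<le> 3 * \<eta>\<^sup>2 * (1 + \<eta>)"
    and ratio: "\<And>k. 2 \<le> k \<Longrightarrow> \<eta> \<le> tau t k / tau t (k - 1)"
  shows "history_weight t g j \<le> history_weight t g (Suc j)"
proof (cases "j = 0")
  case True
  then show ?thesis
    using moment_le_own_gap[OF mesh g, of 1] pos[of "t 0"] moment_weight_nonneg[OF mesh g, of 0]
    by (simp add: history_weight_def)
next
  case False
  have "0 \<le> cell_moment t g j / (tau t j * (tau t j + tau t (j + 1)))"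
    using cell_moment_nonneg[OF mesh g, of j] tau_pos[OF mesh, of j] tau_pos[OF mesh, of "j + 1"] False by auto
  moreover have "moment_weight t g (j - 1) \<le> g (t j) - cell_mean t g j"
    using moment_weight_le_next_gap[OF mesh g \<eta> ratio, of "j - 1"] False by simp
  moreover note moment_le_own_gap[OF mesh g, of "Suc j"] moment_weight_nonneg[OF mesh g, of j]
  ultimately show ?thesis by (simp add: history_weight_def)
qed

text \<open>The gap in this inequality is linear in \<open>g\<close>. Applied to the difference of two successive
  kernels, it says that the gap decreases from one level to the next.\<close>

lemma history_weight_le_end_value:
  assumes mesh: "strict_mono t" and g: "convex_increasing g g'" and j: "1 \<le> j"
    and \<eta>: "0 < \<eta>" "1 \<le> 3 * \<eta>\<^sup>2 * (1 + \<eta>)"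
    and ratio: "\<And>k. 2 \<le> k \<Longrightarrow> \<eta> \<le> tau t k / tau t (k - 1)"
  shows "history_weight t g j \<le> g (t j) + 2 * moment_weight t g j"
proof -
  have "0 \<le> cell_moment t g j / (tau t j * (tau t j + tau t (j + 1)))"
    using cell_moment_nonneg[OF mesh g, of j] tau_pos[OF mesh, of j] tau_pos[OF mesh, of "j + 1"] j by auto
  moreover have "moment_weight t g (j - 1) \<le> g (t j) - cell_mean t g j"
    using moment_weight_le_next_gap[OF mesh g \<eta> ratio, of "j - 1"] j by simp
  ultimately show ?thesis
    using moment_weight_nonneg[OF mesh g, of j] by (simp add: history_weight_def)
qed

lemma history_weight_Suc_le_end_value:
  assumes mesh: "strict_mono t" and g: "convex_increasing g g'"
  shows "history_weight t g (Suc j) \<le> g (t (Suc j)) + moment_weight t g j"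
proof -
  have pos: "0 < tau t (j + 1)" "0 < tau t (j + 2)" using tau_pos[OF mesh] by auto
  have "cell_mean t g (Suc j) \<le> g (t (Suc j))"
  proof -
    have "0 \<le> g' (t j) * tau t (Suc j) / 2" using g pos by (simp add: convex_increasing_def)
    then show ?thesis using slope_le_cell_mean_gap[OF mesh g, of "Suc j"] by simp
  qed
  moreover have "0 \<le> cell_moment t g (Suc j) / (tau t (Suc j) * (tau t (Suc j) + tau t (Suc j + 1)))"
    using pos cell_moment_nonneg[OF mesh g, of "Suc j"] by auto
  moreover note moment_weight_nonneg[OF mesh g, of j]
  ultimately show ?thesis by (simp add: history_weight_def)
qed

section \<open>Coercivity of the fast operator\<close>

lemma powr_decrement_antimono:
  fixes x y h \<alpha> :: real
  assumes "0 < \<alpha>" "0 < x" "x \<le> y" "0 \<le> h"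
  shows "y powr (-\<alpha>) - (y + h) powr (-\<alpha>) \<le> x powr (-\<alpha>) - (x + h) powr (-\<alpha>)"
proof (rule DERIV_nonpos_imp_nonincreasing[OF assms(3)])
  fix z assume "x \<le> z" "z \<le> y"
  then have z: "0 < z" "0 < z + h" using assms by auto
  have "((\<lambda>z. z powr (-\<alpha>) - (z + h) powr (-\<alpha>)) has_real_derivative
      \<alpha> * ((z + h) powr (-\<alpha> - 1) - z powr (-\<alpha> - 1))) (at z)"
    using z by (auto intro!: derivative_eq_intros simp: algebra_simps)
  moreover have "(z + h) powr (-\<alpha> - 1) \<le> z powr (-\<alpha> - 1)"
    using z assms by (intro powr_mono2') auto
  ultimately show "\<exists>d. ((\<lambda>z. z powr (-\<alpha>) - (z + h) powr (-\<alpha>)) has_real_derivative d) (at z) \<and> d \<le> 0"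
    using assms by (auto simp: mult_le_0_iff)
qed

text \<open>The restriction on the first step, multiplied out and divided by
  \<open>(1 - \<alpha>) * (\<sigma> * \<tau>) powr \<alpha>\<close>; the constant \<open>2 - \<alpha>\<close> is \<open>2 * \<sigma>\<close>.\<close>

lemma first_diagonal_bound:
  fixes \<alpha> \<sigma> \<eta> \<tau> L \<epsilon> :: real
  assumes \<alpha>: "0 < \<alpha>" "\<alpha> < 1" and \<sigma>: "\<sigma> = 1 - \<alpha> / 2" and \<eta>: "0 < \<eta>" and \<tau>: "0 < \<tau>"
    and L: "0 < L" and \<epsilon>: "0 < \<epsilon>"
    and step: "\<tau> powr \<alpha> \<le> (2 - \<alpha> - (1 - \<alpha>) * \<eta> powr (-\<alpha>)) /
          (\<sigma> powr \<alpha> * ((3 - \<alpha>) * Gamma (2 - \<alpha>) * L + (1 - \<alpha>) * \<epsilon>))"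
  shows "(3 - \<alpha>) * Gamma (1 - \<alpha>) * L + ((\<sigma> * (\<eta> * \<tau>)) powr (-\<alpha>) + \<epsilon>)
    \<le> 2 * (\<sigma> powr (1 - \<alpha>) / ((1 - \<alpha>) * \<tau> powr \<alpha>))"
proof -
  define X S G where "X = \<tau> powr \<alpha>" and "S = \<sigma> powr \<alpha>" and "G = Gamma (1 - \<alpha>)"
  have \<sigma>0: "0 < \<sigma>" using \<alpha> \<sigma> by simp
  have pos: "0 < X" "0 < S" "0 < G" using \<alpha> \<sigma>0 \<tau> by (auto simp: X_def S_def G_def)
  have Gam: "Gamma (2 - \<alpha>) = (1 - \<alpha>) * G"
    using Gamma_plus1[of "1 - \<alpha>"] \<alpha> by (force simp: G_def elim!: nonpos_Ints_cases)
  have D: "0 < S * ((3 - \<alpha>) * Gamma (2 - \<alpha>) * L + (1 - \<alpha>) * \<epsilon>)"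
    using pos \<alpha> L \<epsilon> by (auto simp: Gam intro!: mult_pos_pos add_pos_pos)
  have "X * (S * ((3 - \<alpha>) * Gamma (2 - \<alpha>) * L + (1 - \<alpha>) * \<epsilon>)) \<le> 2 - \<alpha> - (1 - \<alpha>) * \<eta> powr (-\<alpha>)"
    using step D unfolding X_def[symmetric] S_def[symmetric] by (simp add: le_divide_eq)
  then have "((3 - \<alpha>) * G * L + \<epsilon>) * ((1 - \<alpha>) * S * X) \<le> 2 * \<sigma> - (1 - \<alpha>) * \<eta> powr (-\<alpha>)"
    by (simp add: Gam \<sigma> algebra_simps)
  then have "(3 - \<alpha>) * G * L + \<epsilon> \<le> (2 * \<sigma> - (1 - \<alpha>) * \<eta> powr (-\<alpha>)) / ((1 - \<alpha>) * S * X)"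
    using pos \<alpha> by (subst le_divide_eq) (auto simp: mult_pos_pos)
  also have "\<dots> = 2 * (\<sigma> / S / ((1 - \<alpha>) * X)) - \<eta> powr (-\<alpha>) / (S * X)"
    using pos \<alpha> by (simp add: field_simps)
  also have "\<sigma> / S = \<sigma> powr (1 - \<alpha>)" using \<sigma>0 by (simp add: powr_diff S_def)
  also have "\<eta> powr (-\<alpha>) / (S * X) = (\<sigma> * (\<eta> * \<tau>)) powr (-\<alpha>)"
    using \<sigma>0 \<eta> \<tau> by (simp add: powr_mult powr_minus S_def X_def divide_inverse)
  finally show ?thesis by (simp add: X_def G_def)
qed

text \<open>The same computation for later steps. Here \<open>2 * \<sigma> = 1 + (1 - \<alpha>)\<close>, and the part \<open>1 - \<alpha>\<close>
  pays for the term \<open>(\<sigma> * \<tau>) powr (-\<alpha>)\<close>.\<close>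

lemma later_diagonal_bound:
  fixes \<alpha> \<sigma> \<eta> \<tau> L \<epsilon> :: real
  assumes \<alpha>: "0 < \<alpha>" "\<alpha> < 1" and \<sigma>: "\<sigma> = 1 - \<alpha> / 2" and \<eta>: "0 < \<eta>" and \<tau>: "0 < \<tau>"
    and L: "0 < L" and \<epsilon>: "0 < \<epsilon>"
    and step: "\<tau> powr \<alpha> \<le>
          (1 - (1 - \<alpha>) * \<sigma> powr \<alpha> * ((\<sigma> * \<eta>) powr (-\<alpha>) - (\<sigma> * \<eta> + 1) powr (-\<alpha>))) /
          (\<sigma> powr \<alpha> * ((3 - \<alpha>) * Gamma (2 - \<alpha>) * L + 3 * (1 - \<alpha>) * \<epsilon>))"
  shows "(3 - \<alpha>) * Gamma (1 - \<alpha>) * L + ((\<sigma> * \<tau>) powr (-\<alpha>)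
      + ((\<sigma> * (\<eta> * \<tau>)) powr (-\<alpha>) - (\<sigma> * (\<eta> * \<tau>) + \<tau>) powr (-\<alpha>)) + 3 * \<epsilon>)
    \<le> 2 * (\<sigma> powr (1 - \<alpha>) / ((1 - \<alpha>) * \<tau> powr \<alpha>))"
proof -
  define X S G A where "X = \<tau> powr \<alpha>" and "S = \<sigma> powr \<alpha>" and "G = Gamma (1 - \<alpha>)"
    and "A = (\<sigma> * \<eta>) powr (-\<alpha>) - (\<sigma> * \<eta> + 1) powr (-\<alpha>)"
  have \<sigma>0: "0 < \<sigma>" using \<alpha> \<sigma> by simp
  have pos: "0 < X" "0 < S" "0 < G" using \<alpha> \<sigma>0 \<tau> by (auto simp: X_def S_def G_def)
  have Gam: "Gamma (2 - \<alpha>) = (1 - \<alpha>) * G"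
    using Gamma_plus1[of "1 - \<alpha>"] \<alpha> by (force simp: G_def elim!: nonpos_Ints_cases)
  have D: "0 < S * ((3 - \<alpha>) * Gamma (2 - \<alpha>) * L + 3 * (1 - \<alpha>) * \<epsilon>)"
    using pos \<alpha> L \<epsilon> by (auto simp: Gam intro!: mult_pos_pos add_pos_pos)
  have "X * (S * ((3 - \<alpha>) * Gamma (2 - \<alpha>) * L + 3 * (1 - \<alpha>) * \<epsilon>)) \<le> 1 - (1 - \<alpha>) * S * A"
    using step D unfolding X_def[symmetric] S_def[symmetric] A_def[symmetric] by (simp add: le_divide_eq)
  then have "((3 - \<alpha>) * G * L + 3 * \<epsilon>) * ((1 - \<alpha>) * S * X) \<le> 2 * \<sigma> - (1 - \<alpha>) - (1 - \<alpha>) * S * A"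
    by (simp add: Gam \<sigma> algebra_simps)
  then have "(3 - \<alpha>) * G * L + 3 * \<epsilon> \<le> (2 * \<sigma> - (1 - \<alpha>) - (1 - \<alpha>) * S * A) / ((1 - \<alpha>) * S * X)"
    using pos \<alpha> by (subst le_divide_eq) (auto simp: mult_pos_pos)
  also have "\<dots> = 2 * (\<sigma> / S / ((1 - \<alpha>) * X)) - 1 / (S * X) - A / X"
  proof -
    have "(2 * \<sigma> - r - r * S * A) / (r * S * X) = 2 * (\<sigma> / S / (r * X)) - 1 / (S * X) - A / X"
      if "0 < r" for r using pos that by (simp add: diff_divide_distrib)
    from this[of "1 - \<alpha>"] show ?thesis using \<alpha> by simp
  qed
  also have "\<sigma> / S = \<sigma> powr (1 - \<alpha>)" using \<sigma>0 by (simp add: powr_diff S_def)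
  also have "1 / (S * X) = (\<sigma> * \<tau>) powr (-\<alpha>)"
    using \<sigma>0 \<tau> by (simp add: powr_mult powr_minus S_def X_def divide_inverse)
  also have "A / X = (\<sigma> * (\<eta> * \<tau>)) powr (-\<alpha>) - (\<sigma> * (\<eta> * \<tau>) + \<tau>) powr (-\<alpha>)"
  proof -
    have "\<sigma> * (\<eta> * \<tau>) + \<tau> = (\<sigma> * \<eta> + 1) * \<tau>" "\<sigma> * (\<eta> * \<tau>) = (\<sigma> * \<eta>) * \<tau>"
      by (simp_all add: algebra_simps)
    moreover have "((\<sigma> * \<eta> + 1) * \<tau>) powr (-\<alpha>) = (\<sigma> * \<eta> + 1) powr (-\<alpha>) * \<tau> powr (-\<alpha>)"
      "((\<sigma> * \<eta>) * \<tau>) powr (-\<alpha>) = (\<sigma> * \<eta>) powr (-\<alpha>) * \<tau> powr (-\<alpha>)"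
      using \<sigma>0 \<eta> \<tau> by (auto intro!: powr_mult)
    moreover have "A / X = A * \<tau> powr (-\<alpha>)"
      by (simp add: X_def powr_minus divide_inverse)
    ultimately show ?thesis by (simp only: A_def left_diff_distrib)
  qed
  finally show ?thesis by (simp add: X_def G_def)
qed

text \<open>In the last bound let \<open>h\<close> be the difference of the kernels of levels \<open>k + 1\<close> and \<open>k + 2\<close>. The
  first and third coefficient and part of the local term combine into functionals of \<open>h\<close>, which
  are controlled by \<open>h (t k)\<close>. What is left is one coefficient of level \<open>k + 2\<close> and its local
  term, controlled by the value of the later kernel at \<open>t (k + 1)\<close>.\<close>

lemma soe_history_weight_bounds:
  fixes t :: "nat \<Rightarrow> real"
  assumes mesh: "strict_mono t" and pos: "\<forall>l\<in>{1..Nq}. 0 \<le> \<theta> l \<and> 0 \<le> \<omega> l"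
    and \<sigma>: "0 < \<sigma>" "\<sigma> \<le> 1"
    and \<eta>: "0 < \<eta>" "1 \<le> 3 * \<eta>\<^sup>2 * (1 + \<eta>)"
    and ratio: "\<And>k. 2 \<le> k \<Longrightarrow> \<eta> \<le> tau t k / tau t (k - 1)"
  defines "K \<equiv> soe_kernel Nq \<theta> \<omega>" and "d \<equiv> d_hat \<sigma> Nq \<theta> \<omega> t" and "c \<equiv> c_hat \<sigma> Nq \<theta> \<omega> t"
  shows "d k 0 = 0"
    and "d k j \<le> d k (Suc j)"
    and "d (Suc k) (Suc j) - d (Suc k) j \<le> d k (Suc j) - d k j"
    and "d (Suc k) k \<le> K (\<sigma> * tau t (Suc k)) + c (Suc k) (k - 1)"
    and "1 \<le> k \<Longrightarrow> d (Suc k) k + d (Suc (Suc k)) (Suc k) - d (Suc (Suc k)) k - 2 * c (Suc k) k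
      \<le> K (\<sigma> * tau t (Suc k)) + (K (\<sigma> * tau t (Suc (Suc k))) - K (\<sigma> * tau t (Suc (Suc k)) + tau t (Suc k)))"
proof -
  define g where "g k s = K (tstar \<sigma> t k - s)" for k s
  have d: "d k j = history_weight t (g k) j" for k j
    unfolding d_def d_hat_eq[OF mesh] g_def K_def ..
  have c: "c k j = moment_weight t (g k) j" for k j
    unfolding c_def c_hat_eq g_def K_def ..
  define g' where "g' k s = (\<Sum>l=1..Nq. \<omega> l * \<theta> l * exp (- \<theta> l * (tstar \<sigma> t k - s)))" for k s
  have g': "convex_increasing (g k) (g' k)" for k
    unfolding g_def[abs_def] g'_def[abs_def] K_def by (rule convex_increasing_soe_kernel[OF pos])
  have cont: "continuous_on UNIV (g k)" for k
    using convex_increasing_continuous[OF g'] .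
  have g_pos: "0 \<le> g k s" for k s
    unfolding g_def K_def soe_kernel_def using pos by (intro sum_nonneg) auto
  have star: "tstar \<sigma> t k \<le> tstar \<sigma> t (Suc k)" for k
  proof -
    have "t (k - 1) \<le> t k" "t k \<le> t (Suc k)" using mesh by (auto simp: strict_mono_less_eq)
    moreover have "\<sigma> * (t k - t (k - 1)) \<le> t k - t (k - 1)"
      using \<sigma> calculation by (intro mult_left_le_one_le) auto
    ultimately show ?thesis using \<sigma> by (simp add: tstar_def tau_def add_increasing2)
  qed
  define h where "h k s = g k s - g (Suc k) s" for k s
  have "\<exists>h'. convex_increasing (h k) h'" for k
    unfolding h_def[abs_def] g_def[abs_def] K_def by (rule convex_increasing_soe_kernel_diff[OF pos star])
  then obtain h' where h': "convex_increasing (h k) (h' k)" for k by metis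
  have h_pos: "0 \<le> h k s" for k s
    unfolding h_def g_def K_def using soe_kernel_antimono[OF pos] star by simp
  have hd: "history_weight t (h k) j = d k j - d (Suc k) j" for k j
    unfolding h_def[abs_def] d by (rule history_weight_diff[OF cont cont])
  have hc: "moment_weight t (h k) j = c k j - c (Suc k) j" for k j
    unfolding h_def[abs_def] c by (rule moment_weight_diff[OF cont cont])
  have gt: "g (Suc k) (t k) = K (\<sigma> * tau t (Suc k))" for k
    by (simp add: g_def tstar_def)
  have gt': "g (Suc (Suc k)) (t k) = K (\<sigma> * tau t (Suc (Suc k)) + tau t (Suc k))" for k
    by (simp add: g_def tstar_def tau_def algebra_simps)
  show "d k 0 = 0" by (simp add: d)
  show "d k j \<le> d k (Suc j)"
    unfolding d by (rule history_weight_le_Suc[OF mesh g' g_pos \<eta> ratio])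
  show "d (Suc k) (Suc j) - d (Suc k) j \<le> d k (Suc j) - d k j"
    using history_weight_le_Suc[OF mesh h' h_pos \<eta> ratio, of k j] unfolding hd by simp
  show "d (Suc k) k \<le> K (\<sigma> * tau t (Suc k)) + c (Suc k) (k - 1)"
  proof (cases k)
    case 0
    have "0 \<le> g (Suc 0) (t 0)" by (rule g_pos)
    then show ?thesis using 0 by (simp add: d c moment_weight_def gt)
  next
    case (Suc m)
    then show ?thesis
      using history_weight_Suc_le_end_value[OF mesh g', of "Suc k" m] by (simp add: d c gt)
  qed
  show "d (Suc k) k + d (Suc (Suc k)) (Suc k) - d (Suc (Suc k)) k - 2 * c (Suc k) k
      \<le> K (\<sigma> * tau t (Suc k)) + (K (\<sigma> * tau t (Suc (Suc k))) - K (\<sigma> * tau t (Suc (Suc k)) + tau t (Suc k)))"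
    if "1 \<le> k"
  proof -
    have "d (Suc k) k - d (Suc (Suc k)) k \<le> h (Suc k) (t k) + 2 * (c (Suc k) k - c (Suc (Suc k)) k)"
      using history_weight_le_end_value[OF mesh h' that \<eta> ratio, of "Suc k"] unfolding hd hc .
    moreover have "d (Suc (Suc k)) (Suc k) \<le> g (Suc (Suc k)) (t (Suc k)) + c (Suc (Suc k)) k"
      using history_weight_Suc_le_end_value[OF mesh g', of "Suc (Suc k)" k] unfolding d c .
    moreover have "0 \<le> c (Suc (Suc k)) k"
      unfolding c by (rule moment_weight_nonneg[OF mesh g'])
    ultimately show ?thesis by (simp add: h_def gt gt')
  qed
qed

text \<open>Twice \<open>Gamma (1 - \<alpha>)\<close> times the difference of the two sides is the form of
  \<open>quadratic_form_nonneg\<close> plus a nonnegative diagonal. For \<open>k \<ge> 2\<close> the sum of exponentials is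
  compared with the power at three points of the range where it is accurate.\<close>

lemma fast_L21sigma_coercive:
  fixes t y :: "nat \<Rightarrow> real"
  assumes \<alpha>: "0 < \<alpha>" "\<alpha> < 1" and \<sigma>: "\<sigma> = 1 - \<alpha> / 2"
    and soe: "0 < \<epsilon>" "soe_approximation \<alpha> \<epsilon> \<Delta>t Tsoe Nq \<theta> \<omega>"
    and L: "0 < L"
    and \<eta>: "0 < \<eta>" "1 - 3 * \<eta>\<^sup>2 * (1 + \<eta>) = 0"
    and mesh: "strict_mono t"
    and ratio: "\<And>k. 2 \<le> k \<Longrightarrow> \<eta> \<le> tau t k / tau t (k - 1)"
    and \<Delta>t_le: "\<And>k. 2 \<le> k \<Longrightarrow> \<Delta>t \<le> \<sigma> * tau t k"
    and Tsoe_ge: "\<And>k. 2 \<le> k \<Longrightarrow> \<sigma> * tau t (k + 1) + tau t k \<le> Tsoe"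
    and first_step: "tau t 1 powr \<alpha> \<le>
          (2 - \<alpha> - (1 - \<alpha>) * \<eta> powr (-\<alpha>)) /
          (\<sigma> powr \<alpha> * ((3 - \<alpha>) * Gamma (2 - \<alpha>) * L + (1 - \<alpha>) * \<epsilon>))"
    and steps: "\<And>k. 2 \<le> k \<Longrightarrow> tau t k powr \<alpha> \<le>
          (1 - (1 - \<alpha>) * \<sigma> powr \<alpha> * ((\<sigma> * \<eta>) powr (-\<alpha>) - (\<sigma> * \<eta> + 1) powr (-\<alpha>))) /
          (\<sigma> powr \<alpha> * ((3 - \<alpha>) * Gamma (2 - \<alpha>) * L + 3 * (1 - \<alpha>) * \<epsilon>))"
  shows "(\<Sum>k=1..n. (3 - \<alpha>) / 2 * L * (delta y k)\<^sup>2)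
    \<le> (\<Sum>k=1..n. fast_L21sigma \<alpha> \<sigma> Nq \<theta> \<omega> t k y * delta y k)"
proof -
  define K where "K = soe_kernel Nq \<theta> \<omega>"
  define d where "d = d_hat \<sigma> Nq \<theta> \<omega> t"
  define c where "c = c_hat \<sigma> Nq \<theta> \<omega> t"
  define G where "G = Gamma (1 - \<alpha>)"
  define e where "e k = \<sigma> powr (1 - \<alpha>) / ((1 - \<alpha>) * tau t k powr \<alpha>)" for k
  define diag where "diag k = d (Suc k) k + d (Suc (Suc k)) (Suc k) - d (Suc (Suc k)) k" for k
  have \<sigma>0: "0 < \<sigma>" "\<sigma> \<le> 1" using \<alpha> \<sigma> by simp_all
  have G: "0 < G" using \<alpha> by (simp add: G_def)
  have Gam: "Gamma (2 - \<alpha>) = (1 - \<alpha>) * G"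
    using Gamma_plus1[of "1 - \<alpha>"] \<alpha> by (force simp: G_def elim!: nonpos_Ints_cases)
  have pos: "\<forall>l\<in>{1..Nq}. 0 \<le> \<theta> l \<and> 0 \<le> \<omega> l"
    using soe(2) by (auto simp: soe_approximation_def less_imp_le)
  have \<eta>': "1 \<le> 3 * \<eta>\<^sup>2 * (1 + \<eta>)" using \<eta> by simp
  note props = soe_history_weight_bounds[OF mesh pos \<sigma>0 \<eta>(1) \<eta>' ratio, folded K_def d_def c_def]
  have \<tau>: "0 < tau t (Suc k)" for k using tau_pos[OF mesh] by simp
  have soe_le: "K s \<le> s powr (-\<alpha>) + \<epsilon>" "s powr (-\<alpha>) - \<epsilon> \<le> K s"
    if "\<Delta>t \<le> s" "s \<le> Tsoe" for s
  proof -
    have "\<bar>s powr (-\<alpha>) - K s\<bar> \<le> \<epsilon>"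
      using soe(2) that unfolding soe_approximation_def K_def soe_kernel_def by simp
    then show "K s \<le> s powr (-\<alpha>) + \<epsilon>" "s powr (-\<alpha>) - \<epsilon> \<le> K s" by linarith+
  qed
  have range: "\<Delta>t \<le> \<sigma> * tau t k" "\<sigma> * tau t k \<le> Tsoe" if "2 \<le> k" for k
  proof -
    have "\<sigma> * tau t k \<le> tau t k" "0 \<le> \<sigma> * tau t (k + 1)"
      using \<sigma>0 \<tau>[of "k - 1"] \<tau>[of k] that by (auto intro: mult_left_le_one_le)
    then show "\<Delta>t \<le> \<sigma> * tau t k" "\<sigma> * tau t k \<le> Tsoe"
      using \<Delta>t_le[OF that] Tsoe_ge[OF that] by linarith+
  qed
  have next_ge: "\<sigma> * (\<eta> * tau t (Suc k)) \<le> \<sigma> * tau t (Suc (Suc k))" for k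
    using ratio[of "Suc (Suc k)"] \<tau>[of k] \<sigma>0 by (simp add: le_divide_eq)
  have diag_le: "(3 - \<alpha>) * G * L + diag k \<le> 2 * (c (Suc k) k + e (Suc k))" for k
  proof (cases "k = 0")
    case True
    \<comment> \<open>The first cell may reach beyond the range of the approximation. As the kernel decreases,
      only its value at the near end of the cell is needed.\<close>
    have "diag 0 \<le> K (\<sigma> * tau t 2)"
      using props(4)[of 1] props(1)
      by (simp add: diag_def numeral_2_eq_2) (simp add: c_def c_hat_def)
    also have "\<dots> \<le> (\<sigma> * tau t 2) powr (-\<alpha>) + \<epsilon>"
      using soe_le range by simp
    also have "(\<sigma> * tau t 2) powr (-\<alpha>) \<le> (\<sigma> * (\<eta> * tau t 1)) powr (-\<alpha>)"
      using next_ge[of 0] \<sigma>0 \<eta> \<tau>[of 0] \<alpha> by (intro powr_mono2') (auto simp: numeral_2_eq_2)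
    finally have "(3 - \<alpha>) * G * L + diag 0 \<le> 2 * e 1"
      using first_diagonal_bound[OF \<alpha> \<sigma> \<eta>(1) _ L soe(1) first_step] \<tau>[of 0]
      by (simp add: e_def G_def)
    then show ?thesis using True by (simp add: c_def c_hat_def)
  next
    case False
    let ?\<tau> = "tau t (Suc k)" and ?s = "\<sigma> * tau t (Suc (Suc k))"
    have "diag k - 2 * c (Suc k) k \<le> K (\<sigma> * ?\<tau>) + (K ?s - K (?s + ?\<tau>))"
      using props(5)[of k] False by (simp add: diag_def)
    moreover have "K (\<sigma> * ?\<tau>) \<le> (\<sigma> * ?\<tau>) powr (-\<alpha>) + \<epsilon>"
      using soe_le(1) range False by simp
    moreover have "K ?s \<le> ?s powr (-\<alpha>) + \<epsilon>"
      using soe_le(1) range by simp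
    moreover have "K (?s + ?\<tau>) \<ge> (?s + ?\<tau>) powr (-\<alpha>) - \<epsilon>"
      using soe_le(2)[of "?s + ?\<tau>"] range(1)[of "Suc (Suc k)"] Tsoe_ge[of "Suc k"] \<tau>[of k] False by simp
    moreover have "?s powr (-\<alpha>) - (?s + ?\<tau>) powr (-\<alpha>)
        \<le> (\<sigma> * (\<eta> * ?\<tau>)) powr (-\<alpha>) - (\<sigma> * (\<eta> * ?\<tau>) + ?\<tau>) powr (-\<alpha>)"
      using next_ge \<alpha> \<sigma>0 \<eta> \<tau>[of k] by (intro powr_decrement_antimono) auto
    ultimately have "diag k - 2 * c (Suc k) k \<le> (\<sigma> * ?\<tau>) powr (-\<alpha>)
        + ((\<sigma> * (\<eta> * ?\<tau>)) powr (-\<alpha>) - (\<sigma> * (\<eta> * ?\<tau>) + ?\<tau>) powr (-\<alpha>)) + 3 * \<epsilon>"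
      by simp
    with later_diagonal_bound[OF \<alpha> \<sigma> \<eta>(1) \<tau> L soe(1) steps[of "Suc k"]] False
    show ?thesis by (simp add: e_def G_def)
  qed
  define z where "z k = delta y (Suc k)" for k
  have "0 \<le> (\<Sum>k<n. 2 * z k * (\<Sum>j<k. d (Suc k) (Suc j) * z j) + diag k * (z k)\<^sup>2)"
    unfolding diag_def by (rule quadratic_form_nonneg) (use props in auto)
  also have "\<dots> \<le> (\<Sum>k<n. 2 * G * (fast_L21sigma \<alpha> \<sigma> Nq \<theta> \<omega> t (Suc k) y * z k - (3 - \<alpha>) / 2 * L * (z k)\<^sup>2))"
  proof (rule sum_mono)
    fix k
    have "fast_L21sigma \<alpha> \<sigma> Nq \<theta> \<omega> t (Suc k) y
        = 1 / G * (c (Suc k) k * z k + (\<Sum>j<k. d (Suc k) (Suc j) * z j)) + e (Suc k) / G * z k"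
      unfolding fast_L21sigma_def Gam G_def[symmetric] c_def[symmetric] d_def[symmetric] e_def z_def
      by (simp add: sum.atLeast1_atMost_eq mult_ac)
    then have GF: "G * fast_L21sigma \<alpha> \<sigma> Nq \<theta> \<omega> t (Suc k) y
        = c (Suc k) k * z k + (\<Sum>j<k. d (Suc k) (Suc j) * z j) + e (Suc k) * z k"
      using G by (simp add: distrib_left)
    have "2 * G * (fast_L21sigma \<alpha> \<sigma> Nq \<theta> \<omega> t (Suc k) y * z k)
        = 2 * z k * (G * fast_L21sigma \<alpha> \<sigma> Nq \<theta> \<omega> t (Suc k) y)"
      by (simp only: mult_ac)
    also have "\<dots> = 2 * z k * (\<Sum>j<k. d (Suc k) (Suc j) * z j) + 2 * (c (Suc k) k + e (Suc k)) * (z k)\<^sup>2"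
      unfolding GF by (simp add: distrib_left distrib_right power2_eq_square)
    finally have "2 * G * (fast_L21sigma \<alpha> \<sigma> Nq \<theta> \<omega> t (Suc k) y * z k)
        = 2 * z k * (\<Sum>j<k. d (Suc k) (Suc j) * z j) + 2 * (c (Suc k) k + e (Suc k)) * (z k)\<^sup>2" .
    moreover have "((3 - \<alpha>) * G * L + diag k) * (z k)\<^sup>2 \<le> 2 * (c (Suc k) k + e (Suc k)) * (z k)\<^sup>2"
      by (intro mult_right_mono diag_le) auto
    moreover have "2 * G * (p - (3 - \<alpha>) / 2 * L * q) = 2 * G * p - (3 - \<alpha>) * G * L * q" for p q
      by (simp add: field_simps)
    ultimately show "2 * z k * (\<Sum>j<k. d (Suc k) (Suc j) * z j) + diag k * (z k)\<^sup>2
        \<le> 2 * G * (fast_L21sigma \<alpha> \<sigma> Nq \<theta> \<omega> t (Suc k) y * z k - (3 - \<alpha>) / 2 * L * (z k)\<^sup>2)"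
      by (simp only: distrib_right)
  qed
  finally have "0 \<le> (\<Sum>k<n. fast_L21sigma \<alpha> \<sigma> Nq \<theta> \<omega> t (Suc k) y * z k - (3 - \<alpha>) / 2 * L * (z k)\<^sup>2)"
    using G unfolding sum_distrib_left[symmetric] by (simp add: zero_le_mult_iff)
  then show ?thesis
    by (simp add: sum_subtractf sum.atLeast1_atMost_eq z_def)
qed

section \<open>The test spaces are closed under differences\<close>

lemma frechet_derivative_diff_at:
  assumes "f differentiable (at x)" "g differentiable (at x)"
  shows "frechet_derivative (\<lambda>x. f x - g x) (at x)
    = (\<lambda>h. frechet_derivative f (at x) h - frechet_derivative g (at x) h)"
  using assms by (intro frechet_derivative_at[symmetric] has_derivative_diff)
    (auto simp: frechet_derivative_works[symmetric])

lemma times_differentiable_diff: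
  assumes "times_differentiable m \<phi>" "times_differentiable m \<psi>"
  shows "times_differentiable m (\<lambda>x. \<phi> x - \<psi> x)"
  using assms by (induction m arbitrary: \<phi> \<psi>) (auto simp: frechet_derivative_diff_at)

lemma test_function_differentiable:
  assumes "test_function \<Omega> \<phi>" shows "\<phi> differentiable (at x)"
proof -
  have "times_differentiable (Suc 0) \<phi>" using assms unfolding test_function_def by blast
  then show ?thesis by simp
qed

lemma continuous_on_test_function:
  assumes "test_function \<Omega> \<phi>" shows "continuous_on UNIV \<phi>"
  using test_function_differentiable[OF assms]
  by (meson continuous_at_imp_continuous_on differentiable_imp_continuous_within)

lemma continuous_on_grad_test_function:
  assumes "test_function \<Omega> \<phi>" shows "continuous_on UNIV (grad \<phi>)"
proof -
  have "times_differentiable (Suc (Suc 0)) \<phi>" using assms unfolding test_function_def by blast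
  then have "\<forall>b\<in>Basis. \<forall>x. (\<lambda>x. frechet_derivative \<phi> (at x) b) differentiable (at x)" by simp
  then have "continuous_on UNIV (\<lambda>x. frechet_derivative \<phi> (at x) b)" if "b \<in> Basis" for b
    using that by (meson continuous_at_imp_continuous_on differentiable_imp_continuous_within)
  then show ?thesis unfolding grad_def[abs_def] by (intro continuous_intros)
qed

lemma grad_diff:
  assumes "\<phi> differentiable (at x)" "\<psi> differentiable (at x)"
  shows "grad (\<lambda>x. \<phi> x - \<psi> x) x = grad \<phi> x - grad \<psi> x"
  by (simp add: grad_def frechet_derivative_diff_at[OF assms] scaleR_left_diff_distrib sum_subtractf)

lemma zero_outside_support: "x \<notin> closure {x. \<phi> x \<noteq> 0} \<Longrightarrow> \<phi> x = 0"
  using closure_subset[of "{x. \<phi> x \<noteq> 0}"] by blast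

lemma grad_zero_outside_support:
  assumes "x \<notin> closure {x. \<phi> x \<noteq> 0}" shows "grad \<phi> x = 0"
proof -
  have "((\<lambda>_. 0) has_derivative (\<lambda>_. 0)) (at x)" by simp
  then have "(\<phi> has_derivative (\<lambda>_. 0)) (at x)"
  proof (rule has_derivative_transform_within_open)
    show "open (- closure {x. \<phi> x \<noteq> 0})" by (rule open_Compl) (rule closed_closure)
    show "x \<in> - closure {x. \<phi> x \<noteq> 0}" using assms unfolding Compl_iff .
    show "0 = \<phi> y" if "y \<in> - closure {x. \<phi> x \<noteq> 0}" for y
      using zero_outside_support[of y \<phi>] that by (metis ComplD)
  qed
  then show ?thesis by (simp add: grad_def frechet_derivative_at[symmetric])
qed

lemma test_function_diff:
  assumes "test_function \<Omega> \<phi>" "test_function \<Omega> \<psi>"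
  shows "test_function \<Omega> (\<lambda>x. \<phi> x - \<psi> x)"
proof -
  have sub: "closure {x. \<phi> x - \<psi> x \<noteq> 0} \<subseteq> closure {x. \<phi> x \<noteq> 0} \<union> closure {x. \<psi> x \<noteq> 0}"
    unfolding closure_Un[symmetric] by (rule closure_mono) auto
  have supp: "compact (closure {x. \<phi> x \<noteq> 0} \<union> closure {x. \<psi> x \<noteq> 0})"
      "closure {x. \<phi> x \<noteq> 0} \<union> closure {x. \<psi> x \<noteq> 0} \<subseteq> \<Omega>"
    using assms by (auto simp only: test_function_def intro!: compact_Un)
  have "compact (closure {x. \<phi> x - \<psi> x \<noteq> 0})"
    using compact_Int_closed[OF supp(1) closed_closure, of "{x. \<phi> x - \<psi> x \<noteq> 0}"]
    unfolding Int_absorb1[OF sub] .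
  moreover have "times_differentiable m (\<lambda>x. \<phi> x - \<psi> x)" for m
    using assms by (intro times_differentiable_diff) (auto simp only: test_function_def)
  ultimately show ?thesis
    using subset_trans[OF sub supp(2)] by (simp only: test_function_def) simp
qed

text \<open>A continuous factor with compact support turns local into global integrability. This is what
  allows the integrals in the definition of a weak gradient to be split into differences.\<close>

lemma integrable_mult_compact_support:
  fixes v \<psi> :: "'a::euclidean_space \<Rightarrow> real"
  assumes \<Omega>: "open \<Omega>" and v: "locally_integrable \<Omega> v" and \<psi>: "continuous_on UNIV \<psi>"
    and K: "compact K" "K \<subseteq> \<Omega>" and outside: "\<And>x. x \<notin> K \<Longrightarrow> \<psi> x = 0"
  shows "integrable (lebesgue_on \<Omega>) (\<lambda>x. v x * \<psi> x)"
proof -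
  have vK: "integrable (lebesgue_on K) v" using v K by (auto simp: locally_integrable_def)
  have K': "K \<in> sets lebesgue" and \<Omega>': "\<Omega> \<in> sets lebesgue"
    using K(1) \<Omega> by (auto intro: lmeasurable_compact fmeasurableD)
  have c: "continuous_on K \<psi>" using \<psi> by (rule continuous_on_subset) simp
  obtain C where C: "\<And>x. x \<in> K \<Longrightarrow> norm (\<psi> x) \<le> C"
    using compact_imp_bounded[OF compact_continuous_image[OF c K(1)]] unfolding bounded_iff by auto
  have "integrable (lebesgue_on K) (\<lambda>x. v x * \<psi> x)"
  proof (rule Bochner_Integration.integrable_bound)
    show "integrable (lebesgue_on K) (\<lambda>x. C * v x)" using vK by simp
    show "(\<lambda>x. v x * \<psi> x) \<in> borel_measurable (lebesgue_on K)"
      using vK continuous_imp_measurable_on_sets_lebesgue[OF c K'] by (intro borel_measurable_times) auto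
    show "AE x in lebesgue_on K. norm (v x * \<psi> x) \<le> norm (C * v x)"
    proof (rule AE_I2)
      fix x assume "x \<in> space (lebesgue_on K)"
      then have "norm (\<psi> x) \<le> \<bar>C\<bar>" using C by force
      then show "norm (v x * \<psi> x) \<le> norm (C * v x)"
        by (simp add: abs_mult mult.commute mult_right_mono)
    qed
  qed
  then have "integrable lebesgue (\<lambda>x. indicator K x *\<^sub>R (v x * \<psi> x))"
    using K' by (subst (asm) integrable_restrict_space) auto
  also have "(\<lambda>x. indicator K x *\<^sub>R (v x * \<psi> x)) = (\<lambda>x. indicator \<Omega> x *\<^sub>R (v x * \<psi> x))"
    using outside K by (auto simp: indicator_def fun_eq_iff)
  finally show ?thesis using \<Omega>' by (subst integrable_restrict_space) auto
qed

lemma locally_integrable_diff: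
  "locally_integrable \<Omega> v \<Longrightarrow> locally_integrable \<Omega> w \<Longrightarrow> locally_integrable \<Omega> (\<lambda>x. v x - w x)"
  by (simp add: locally_integrable_def)

lemma locally_integrable_inner:
  "locally_integrable \<Omega> Dv \<Longrightarrow> locally_integrable \<Omega> (\<lambda>x. Dv x \<bullet> b)"
  by (simp add: locally_integrable_def)

lemma weak_gradient_diff:
  assumes \<Omega>: "open \<Omega>" and v: "weak_gradient \<Omega> v Dv" and w: "weak_gradient \<Omega> w Dw"
  shows "weak_gradient \<Omega> (\<lambda>x. v x - w x) (\<lambda>x. Dv x - Dw x)"
  unfolding weak_gradient_def
proof (intro conjI allI impI ballI)
  have lv: "locally_integrable \<Omega> v" "locally_integrable \<Omega> Dv"
    and lw: "locally_integrable \<Omega> w" "locally_integrable \<Omega> Dw"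
    using v w by (simp_all only: weak_gradient_def)
  show "locally_integrable \<Omega> (\<lambda>x. v x - w x)" "locally_integrable \<Omega> (\<lambda>x. Dv x - Dw x)"
    using lv lw by (auto intro: locally_integrable_diff)
  fix \<phi> :: "'a \<Rightarrow> real" and b :: 'a assume \<phi>: "test_function \<Omega> \<phi>" and b: "b \<in> Basis"
  have supp: "compact (closure {x. \<phi> x \<noteq> 0})" "closure {x. \<phi> x \<noteq> 0} \<subseteq> \<Omega>"
    using \<phi> by (auto simp: test_function_def)
  have grad_int: "integrable (lebesgue_on \<Omega>) (\<lambda>x. p x * (grad \<phi> x \<bullet> b))" if "locally_integrable \<Omega> p" for p
    by (intro integrable_mult_compact_support[OF \<Omega> that _ supp] continuous_intros
        continuous_on_grad_test_function[OF \<phi>]) (simp add: grad_zero_outside_support)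
  have val_int: "integrable (lebesgue_on \<Omega>) (\<lambda>x. p x * \<phi> x)" if "locally_integrable \<Omega> p" for p
    by (intro integrable_mult_compact_support[OF \<Omega> that _ supp] continuous_on_test_function[OF \<phi>])
       (rule zero_outside_support)
  have "(\<integral>x. (v x - w x) * (grad \<phi> x \<bullet> b) \<partial>lebesgue_on \<Omega>)
      = (\<integral>x. v x * (grad \<phi> x \<bullet> b) \<partial>lebesgue_on \<Omega>) - (\<integral>x. w x * (grad \<phi> x \<bullet> b) \<partial>lebesgue_on \<Omega>)"
    using lv lw by (simp add: left_diff_distrib grad_int)
  also have "\<dots> = - ((\<integral>x. (Dv x \<bullet> b) * \<phi> x \<partial>lebesgue_on \<Omega>) - (\<integral>x. (Dw x \<bullet> b) * \<phi> x \<partial>lebesgue_on \<Omega>))"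
  proof -
    have "(\<integral>x. v x * (grad \<phi> x \<bullet> b) \<partial>lebesgue_on \<Omega>) = - (\<integral>x. (Dv x \<bullet> b) * \<phi> x \<partial>lebesgue_on \<Omega>)"
        "(\<integral>x. w x * (grad \<phi> x \<bullet> b) \<partial>lebesgue_on \<Omega>) = - (\<integral>x. (Dw x \<bullet> b) * \<phi> x \<partial>lebesgue_on \<Omega>)"
      using v w \<phi> b unfolding weak_gradient_def by blast+
    then show ?thesis by linarith
  qed
  also have "\<dots> = - (\<integral>x. ((Dv x - Dw x) \<bullet> b) * \<phi> x \<partial>lebesgue_on \<Omega>)"
    using lv lw by (simp add: inner_diff_left left_diff_distrib val_int locally_integrable_inner)
  finally show "(\<integral>x. (v x - w x) * (grad \<phi> x \<bullet> b) \<partial>lebesgue_on \<Omega>)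
      = - (\<integral>x. ((Dv x - Dw x) \<bullet> b) * \<phi> x \<partial>lebesgue_on \<Omega>)" .
qed

definition square_integrable :: "'a measure \<Rightarrow> ('a \<Rightarrow> 'b::euclidean_space) \<Rightarrow> bool" where
  "square_integrable M f \<longleftrightarrow> f \<in> borel_measurable M \<and> integrable M (\<lambda>x. (norm (f x))\<^sup>2)"

lemma norm_diff_squared_le:
  fixes a b :: "'b::real_inner"
  shows "(norm (a - b))\<^sup>2 \<le> 2 * (norm a)\<^sup>2 + 2 * (norm b)\<^sup>2"
proof -
  have "0 \<le> (norm (a + b))\<^sup>2" by simp
  then show ?thesis by (simp add: power2_norm_eq_inner inner_diff inner_add inner_commute)
qed

lemma square_integrable_diff:
  assumes "square_integrable M f" "square_integrable M g"
  shows "square_integrable M (\<lambda>x. f x - g x)"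
  unfolding square_integrable_def
proof
  show m: "(\<lambda>x. f x - g x) \<in> borel_measurable M"
    using assms by (auto simp: square_integrable_def)
  show "integrable M (\<lambda>x. (norm (f x - g x))\<^sup>2)"
  proof (rule Bochner_Integration.integrable_bound)
    show "integrable M (\<lambda>x. 2 * (norm (f x))\<^sup>2 + 2 * (norm (g x))\<^sup>2)"
      using assms by (auto simp: square_integrable_def)
    show "(\<lambda>x. (norm (f x - g x))\<^sup>2) \<in> borel_measurable M" using m by measurable
    show "AE x in M. norm ((norm (f x - g x))\<^sup>2) \<le> norm (2 * (norm (f x))\<^sup>2 + 2 * (norm (g x))\<^sup>2)"
      using norm_diff_squared_le by (intro AE_I2) (auto intro: order_trans)
  qed
qed

lemma integrable_inner_square:
  assumes "square_integrable M f" "square_integrable M g"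
  shows "integrable M (\<lambda>x. f x \<bullet> g x)"
proof (rule Bochner_Integration.integrable_bound)
  show "integrable M (\<lambda>x. (norm (f x))\<^sup>2 + (norm (g x))\<^sup>2)"
    using assms by (auto simp: square_integrable_def)
  show "(\<lambda>x. f x \<bullet> g x) \<in> borel_measurable M"
    using assms by (auto simp: square_integrable_def)
  show "AE x in M. norm (f x \<bullet> g x) \<le> norm ((norm (f x))\<^sup>2 + (norm (g x))\<^sup>2)"
  proof (rule AE_I2)
    fix x
    have "\<bar>f x \<bullet> g x\<bar> \<le> norm (f x) * norm (g x)" by (rule Cauchy_Schwarz_ineq2)
    also have "\<dots> \<le> (norm (f x))\<^sup>2 + (norm (g x))\<^sup>2"
    proof -
      have "2 * (norm (f x) * norm (g x)) \<le> (norm (f x))\<^sup>2 + (norm (g x))\<^sup>2"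
        using sum_squares_bound[of "norm (f x)" "norm (g x)"] by (simp only: mult.assoc)
      moreover have "0 \<le> norm (f x) * norm (g x)" by simp
      ultimately show ?thesis by linarith
    qed
    finally show "norm (f x \<bullet> g x) \<le> norm ((norm (f x))\<^sup>2 + (norm (g x))\<^sup>2)" by simp
  qed
qed

lemma H1_iff:
  "(v, Dv) \<in> H1 \<Omega> \<longleftrightarrow> weak_gradient \<Omega> v Dv \<and>
     square_integrable (lebesgue_on \<Omega>) v \<and> square_integrable (lebesgue_on \<Omega>) Dv"
  by (simp add: H1_def square_integrable_def conj_assoc)

lemma H1_diff:
  assumes "open \<Omega>" "(v, Dv) \<in> H1 \<Omega>" "(w, Dw) \<in> H1 \<Omega>"
  shows "(\<lambda>x. v x - w x, \<lambda>x. Dv x - Dw x) \<in> H1 \<Omega>"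
  using assms unfolding H1_iff by (intro conjI weak_gradient_diff square_integrable_diff) simp_all

lemma square_integrable_compact_support:
  fixes \<psi> :: "'a::euclidean_space \<Rightarrow> 'b::euclidean_space"
  assumes \<Omega>: "open \<Omega>" and \<psi>: "continuous_on UNIV \<psi>"
    and K: "compact K" "K \<subseteq> \<Omega>" and outside: "\<And>x. x \<notin> K \<Longrightarrow> \<psi> x = 0"
  shows "square_integrable (lebesgue_on \<Omega>) \<psi>"
proof -
  have one: "locally_integrable \<Omega> (\<lambda>_. 1 :: real)"
  proof (unfold locally_integrable_def, intro allI impI)
    fix S :: "'a set" assume "compact S \<and> S \<subseteq> \<Omega>"
    then interpret finite_measure "lebesgue_on S"
      by (intro finite_measure_lebesgue_on lmeasurable_compact) simp
    show "integrable (lebesgue_on S) (\<lambda>_. 1 :: real)" by simp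
  qed
  have "continuous_on UNIV (\<lambda>x. (norm (\<psi> x))\<^sup>2)" by (intro continuous_intros \<psi>)
  from integrable_mult_compact_support[OF \<Omega> one this K] outside
  have "integrable (lebesgue_on \<Omega>) (\<lambda>x. (norm (\<psi> x))\<^sup>2)" by simp
  moreover have "\<psi> \<in> borel_measurable (lebesgue_on \<Omega>)"
    using \<Omega> continuous_on_subset[OF \<psi>] by (intro continuous_imp_measurable_on_sets_lebesgue) auto
  ultimately show ?thesis by (simp add: square_integrable_def)
qed

lemma square_integrable_test_function:
  assumes "open \<Omega>" and \<phi>: "test_function \<Omega> \<phi>"
  shows "square_integrable (lebesgue_on \<Omega>) \<phi>" "square_integrable (lebesgue_on \<Omega>) (grad \<phi>)"
proof -
  have supp: "compact (closure {x. \<phi> x \<noteq> 0})" "closure {x. \<phi> x \<noteq> 0} \<subseteq> \<Omega>"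
    using \<phi> by (auto simp: test_function_def)
  show "square_integrable (lebesgue_on \<Omega>) \<phi>"
    by (rule square_integrable_compact_support[OF assms(1) continuous_on_test_function[OF \<phi>] supp])
       (rule zero_outside_support)
  show "square_integrable (lebesgue_on \<Omega>) (grad \<phi>)"
    by (rule square_integrable_compact_support[OF assms(1) continuous_on_grad_test_function[OF \<phi>] supp])
       (rule grad_zero_outside_support)
qed

text \<open>If test functions converge to \<open>v\<close> and \<open>w\<close>, their differences converge to the difference by
  \<open>norm_diff_squared_le\<close>, applied to values and gradients under the integral.\<close>

lemma H1_zero_diff:
  assumes \<Omega>: "open \<Omega>" and v: "(v, Dv) \<in> H1_zero \<Omega>" and w: "(w, Dw) \<in> H1_zero \<Omega>"
  shows "(\<lambda>x. v x - w x, \<lambda>x. Dv x - Dw x) \<in> H1_zero \<Omega>"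
proof -
  define dist2 where "dist2 \<phi> p Dp = (\<integral>x. (\<phi> x - p x)\<^sup>2 + (norm (grad \<phi> x - Dp x))\<^sup>2 \<partial>lebesgue_on \<Omega>)"
    for \<phi> p :: "'a \<Rightarrow> real" and Dp :: "'a \<Rightarrow> 'a"
  obtain \<phi> where \<phi>: "\<And>m. test_function \<Omega> (\<phi> m)" "(\<lambda>m. dist2 (\<phi> m) v Dv) \<longlonglongrightarrow> 0"
    using v by (auto simp: H1_zero_def dist2_def)
  obtain \<psi> where \<psi>: "\<And>m. test_function \<Omega> (\<psi> m)" "(\<lambda>m. dist2 (\<psi> m) w Dw) \<longlonglongrightarrow> 0"
    using w by (auto simp: H1_zero_def dist2_def)
  have H1: "(v, Dv) \<in> H1 \<Omega>" "(w, Dw) \<in> H1 \<Omega>" using v w by (auto simp: H1_zero_def)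
  have int: "integrable (lebesgue_on \<Omega>) (\<lambda>x. (\<xi> x - p x)\<^sup>2 + (norm (grad \<xi> x - Dp x))\<^sup>2)"
    if "test_function \<Omega> \<xi>" "(p, Dp) \<in> H1 \<Omega>" for \<xi> p :: "'a \<Rightarrow> real" and Dp
    using square_integrable_diff[OF square_integrable_test_function(1)[OF \<Omega> that(1)], of p]
      square_integrable_diff[OF square_integrable_test_function(2)[OF \<Omega> that(1)], of Dp] that(2)
    by (auto simp: H1_iff square_integrable_def)
  define \<xi> where "\<xi> m x = \<phi> m x - \<psi> m x" for m x
  have \<xi>: "test_function \<Omega> (\<xi> m)" for m
    unfolding \<xi>_def[abs_def] using \<phi> \<psi> by (intro test_function_diff)
  have H1d: "(\<lambda>x. v x - w x, \<lambda>x. Dv x - Dw x) \<in> H1 \<Omega>" by (rule H1_diff[OF \<Omega> H1])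
  have "dist2 (\<xi> m) (\<lambda>x. v x - w x) (\<lambda>x. Dv x - Dw x)
      \<le> 2 * dist2 (\<phi> m) v Dv + 2 * dist2 (\<psi> m) w Dw" for m
  proof -
    have I: "integrable (lebesgue_on \<Omega>) (\<lambda>x. 2 * ((\<phi> m x - v x)\<^sup>2 + (norm (grad (\<phi> m) x - Dv x))\<^sup>2))"
      by (rule integrable_mult_right) (rule int[OF \<phi>(1) H1(1)])
    have J: "integrable (lebesgue_on \<Omega>) (\<lambda>x. 2 * ((\<psi> m x - w x)\<^sup>2 + (norm (grad (\<psi> m) x - Dw x))\<^sup>2))"
      by (rule integrable_mult_right) (rule int[OF \<psi>(1) H1(2)])
    have "dist2 (\<xi> m) (\<lambda>x. v x - w x) (\<lambda>x. Dv x - Dw x)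
        \<le> (\<integral>x. 2 * ((\<phi> m x - v x)\<^sup>2 + (norm (grad (\<phi> m) x - Dv x))\<^sup>2)
              + 2 * ((\<psi> m x - w x)\<^sup>2 + (norm (grad (\<psi> m) x - Dw x))\<^sup>2) \<partial>lebesgue_on \<Omega>)"
      unfolding dist2_def
    proof (rule integral_mono)
      show "integrable (lebesgue_on \<Omega>) (\<lambda>x. (\<xi> m x - (v x - w x))\<^sup>2 + (norm (grad (\<xi> m) x - (Dv x - Dw x)))\<^sup>2)"
        by (rule int[OF \<xi> H1d])
      show "integrable (lebesgue_on \<Omega>) (\<lambda>x. 2 * ((\<phi> m x - v x)\<^sup>2 + (norm (grad (\<phi> m) x - Dv x))\<^sup>2)
              + 2 * ((\<psi> m x - w x)\<^sup>2 + (norm (grad (\<psi> m) x - Dw x))\<^sup>2))"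
        by (rule Bochner_Integration.integrable_add[OF I J])
      fix x
      have "grad (\<xi> m) x = grad (\<phi> m) x - grad (\<psi> m) x"
        unfolding \<xi>_def[abs_def] by (intro grad_diff test_function_differentiable[OF \<phi>(1)] test_function_differentiable[OF \<psi>(1)])
      then have *: "grad (\<xi> m) x - (Dv x - Dw x) = (grad (\<phi> m) x - Dv x) - (grad (\<psi> m) x - Dw x)" by simp
      have grad_le: "(norm (grad (\<xi> m) x - (Dv x - Dw x)))\<^sup>2
          \<le> 2 * (norm (grad (\<phi> m) x - Dv x))\<^sup>2 + 2 * (norm (grad (\<psi> m) x - Dw x))\<^sup>2"
        unfolding * by (rule norm_diff_squared_le)
      have "(\<xi> m x - (v x - w x))\<^sup>2 \<le> 2 * (\<phi> m x - v x)\<^sup>2 + 2 * (\<psi> m x - w x)\<^sup>2"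
        using norm_diff_squared_le[of "\<phi> m x - v x" "\<psi> m x - w x"]
        unfolding \<xi>_def by (simp add: algebra_simps)
      from add_mono[OF this grad_le] show "(\<xi> m x - (v x - w x))\<^sup>2 + (norm (grad (\<xi> m) x - (Dv x - Dw x)))\<^sup>2
          \<le> 2 * ((\<phi> m x - v x)\<^sup>2 + (norm (grad (\<phi> m) x - Dv x))\<^sup>2)
              + 2 * ((\<psi> m x - w x)\<^sup>2 + (norm (grad (\<psi> m) x - Dw x))\<^sup>2)"
        by (simp add: distrib_left)
    qed
    also have "\<dots> = 2 * dist2 (\<phi> m) v Dv + 2 * dist2 (\<psi> m) w Dw"
      unfolding Bochner_Integration.integral_add[OF I J] dist2_def by (simp only: integral_mult_right_zero)
    finally show ?thesis .
  qed
  note upper = this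
  have lower: "0 \<le> dist2 (\<xi> m) (\<lambda>x. v x - w x) (\<lambda>x. Dv x - Dw x)" for m
    unfolding dist2_def by (rule Bochner_Integration.integral_nonneg) simp
  have upper_lim: "(\<lambda>m. 2 * dist2 (\<phi> m) v Dv + 2 * dist2 (\<psi> m) w Dw) \<longlonglongrightarrow> 0"
    using tendsto_add[OF tendsto_mult_left[OF \<phi>(2), of 2] tendsto_mult_left[OF \<psi>(2), of 2]] by simp
  have "(\<lambda>m. dist2 (\<xi> m) (\<lambda>x. v x - w x) (\<lambda>x. Dv x - Dw x)) \<longlonglongrightarrow> 0"
    by (rule tendsto_sandwich[OF always_eventually[OF allI[OF lower]] always_eventually[OF allI[OF upper]]
        tendsto_const upper_lim])
  then have lim: "(\<lambda>m. \<integral>x. (\<xi> m x - (v x - w x))\<^sup>2 + (norm (grad (\<xi> m) x - (Dv x - Dw x)))\<^sup>2 \<partial>lebesgue_on \<Omega>)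
      \<longlonglongrightarrow> 0" by (simp only: dist2_def)
  show ?thesis
    unfolding H1_zero_def mem_Collect_eq case_prod_conv
  proof (rule conjI[OF H1d exI[of _ \<xi>]], rule conjI)
    show "\<forall>m. test_function \<Omega> (\<xi> m)" using \<xi> by (rule allI)
  qed (rule lim)
qed

lemma H1_periodic_diff:
  assumes \<Omega>: "open \<Omega>" and v: "(v, Dv) \<in> H1_periodic P \<Omega>" and w: "(w, Dw) \<in> H1_periodic P \<Omega>"
  shows "(\<lambda>x. v x - w x, \<lambda>x. Dv x - Dw x) \<in> H1_periodic P \<Omega>"
proof -
  obtain v' Dv' where v': "weak_gradient UNIV v' Dv'" "\<forall>p\<in>P. \<forall>x. v' (x + p) = v' x"
      "\<forall>x\<in>\<Omega>. v' x = v x \<and> Dv' x = Dv x" using v by (auto simp: H1_periodic_def)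
  obtain w' Dw' where w': "weak_gradient UNIV w' Dw'" "\<forall>p\<in>P. \<forall>x. w' (x + p) = w' x"
      "\<forall>x\<in>\<Omega>. w' x = w x \<and> Dw' x = Dw x" using w by (auto simp: H1_periodic_def)
  have "(\<lambda>x. v x - w x, \<lambda>x. Dv x - Dw x) \<in> H1 \<Omega>"
    using v w H1_diff[OF \<Omega>] by (auto simp: H1_periodic_def)
  moreover have "weak_gradient UNIV (\<lambda>x. v' x - w' x) (\<lambda>x. Dv' x - Dw' x)"
    by (rule weak_gradient_diff[OF open_UNIV v'(1) w'(1)])
  moreover have "\<forall>p\<in>P. \<forall>x. v' (x + p) - w' (x + p) = v' x - w' x"
    "\<forall>x\<in>\<Omega>. v' x - w' x = v x - w x \<and> Dv' x - Dw' x = Dv x - Dw x"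
    using v'(2,3) w'(2,3) by simp_all
  ultimately show ?thesis
    unfolding H1_periodic_def mem_Collect_eq case_prod_conv
    by (intro conjI exI[of _ "\<lambda>x. v' x - w' x"] exI[of _ "\<lambda>x. Dv' x - Dw' x"])
qed

section \<open>Energy balance of one step\<close>

text \<open>The derivative need not be continuous, but it is the pointwise limit of difference
  quotients of a continuous function.\<close>

lemma deriv_borel_measurable:
  fixes f :: "real \<Rightarrow> real"
  assumes f: "\<And>x. (f has_real_derivative f' x) (at x)"
  shows "f' \<in> borel_measurable borel"
proof (rule borel_measurable_LIMSEQ_real)
  have cont: "continuous_on UNIV f"
    using f by (meson DERIV_isCont continuous_at_imp_continuous_on)
  show "(\<lambda>n. (f (x + 1 / real (Suc n)) - f x) / (1 / real (Suc n))) \<longlonglongrightarrow> f' x" for x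
  proof -
    have "((\<lambda>h. (f (x + h) - f x) / h) \<longlongrightarrow> f' x) (at 0)"
      using f[of x] by (simp add: DERIV_def)
    moreover have "filterlim (\<lambda>n. 1 / real (Suc n)) (at 0) sequentially"
      using LIMSEQ_inverse_real_of_nat by (intro filterlim_atI) (auto simp: inverse_eq_divide)
    ultimately show ?thesis by (rule filterlim_compose)
  qed
  have "f \<in> borel_measurable borel"
    using cont by (rule borel_measurable_continuous_onI)
  then show "(\<lambda>x. (f (x + 1 / real (Suc n)) - f x) / (1 / real (Suc n))) \<in> borel_measurable borel" for n
    by measurable
qed

lemma lipschitz_of_deriv_bound:
  fixes f :: "real \<Rightarrow> real"
  assumes f: "\<And>x. (f has_real_derivative f' x) (at x)" and L: "\<And>x. \<bar>f' x\<bar> \<le> L"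
  shows "\<bar>f b - f a\<bar> \<le> L * \<bar>b - a\<bar>"
  using field_differentiable_bound[of UNIV f f' L b a] f L by simp

text \<open>Taylor's formula of second order, with the remainder bounded through \<open>f'\<close>.\<close>

lemma primitive_diff_le:
  fixes f F :: "real \<Rightarrow> real"
  assumes f: "\<And>x. (f has_real_derivative f' x) (at x)" and L: "\<And>x. \<bar>f' x\<bar> \<le> L"
    and F: "\<And>x. (F has_real_derivative f x) (at x)"
  shows "\<bar>F b - F a - f a * (b - a)\<bar> \<le> L / 2 * (b - a)\<^sup>2"
proof (cases "b = a")
  case False
  define dF where "dF m = (if m = 0 then F else if m = 1 then f else f')" for m :: nat
  have "\<exists>\<xi>. (if b < a then b < \<xi> \<and> \<xi> < a else a < \<xi> \<and> \<xi> < b) \<and>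
      F b = (\<Sum>m<2. (dF m a / fact m) * (b - a) ^ m) + (dF 2 \<xi> / fact 2) * (b - a) ^ 2"
    by (rule Taylor[of 2 dF F "min a b" "max a b"])
       (use False f F in \<open>auto simp: dF_def less_2_cases_iff\<close>)
  then obtain \<xi> where "F b = F a + f a * (b - a) + f' \<xi> / 2 * (b - a)\<^sup>2"
    by (auto simp: dF_def numeral_2_eq_2)
  then have "\<bar>F b - F a - f a * (b - a)\<bar> = \<bar>f' \<xi>\<bar> / 2 * (b - a)\<^sup>2"
    by (simp add: abs_mult)
  also have "\<dots> \<le> L / 2 * (b - a)\<^sup>2"
    by (intro mult_right_mono divide_right_mono L) auto
  finally show ?thesis .
qed simp

lemma square_integrable_const:
  "finite_measure M \<Longrightarrow> square_integrable M (\<lambda>_. c)"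
  using finite_measure.integrable_const[of M "(norm c)\<^sup>2"] by (simp add: square_integrable_def)

lemma square_integrable_bound:
  assumes g: "square_integrable M g" and f: "f \<in> borel_measurable M" and le: "\<And>x. norm (f x) \<le> C * norm (g x)"
  shows "square_integrable M f"
  unfolding square_integrable_def
proof
  show "integrable M (\<lambda>x. (norm (f x))\<^sup>2)"
  proof (rule Bochner_Integration.integrable_bound)
    show "integrable M (\<lambda>x. C\<^sup>2 * (norm (g x))\<^sup>2)" using g by (simp add: square_integrable_def)
    show "(\<lambda>x. (norm (f x))\<^sup>2) \<in> borel_measurable M" using f by measurable
    show "AE x in M. norm ((norm (f x))\<^sup>2) \<le> norm (C\<^sup>2 * (norm (g x))\<^sup>2)"
    proof (rule AE_I2)
      fix x show "norm ((norm (f x))\<^sup>2) \<le> norm (C\<^sup>2 * (norm (g x))\<^sup>2)"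
        using power_mono[OF le[of x], of 2] by (simp add: power_mult_distrib)
    qed
  qed
qed (rule f)

lemma square_integrable_add:
  fixes f g :: "'a \<Rightarrow> 'b::euclidean_space"
  assumes "square_integrable M f" "square_integrable M g"
  shows "square_integrable M (\<lambda>x. f x + g x)"
proof -
  have "square_integrable M (\<lambda>x. - g x)"
    using assms(2) by (simp add: square_integrable_def)
  from square_integrable_diff[OF assms(1) this] show ?thesis by simp
qed

lemma square_integrable_mult_left:
  fixes f :: "'a \<Rightarrow> real"
  assumes "square_integrable M f" shows "square_integrable M (\<lambda>x. c * f x)"
  using assms by (auto simp: square_integrable_def power_mult_distrib)

lemma square_integrable_sum:
  fixes f :: "'i \<Rightarrow> 'a \<Rightarrow> real"
  assumes "finite I" "\<And>i. i \<in> I \<Longrightarrow> square_integrable M (f i)"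
  shows "square_integrable M (\<lambda>x. \<Sum>i\<in>I. f i x)"
  using assms
proof (induction I rule: finite_induct)
  case empty then show ?case by (simp add: square_integrable_def)
next
  case (insert i I)
  then show ?case by (simp add: square_integrable_add)
qed

text \<open>A primitive of a Lipschitz function grows at most quadratically, so it maps square integrable
  functions on a finite measure space to integrable ones.\<close>

lemma integrable_primitive_comp:
  fixes f F v :: "_ \<Rightarrow> real"
  assumes M: "finite_measure M" and v: "square_integrable M v"
    and f: "\<And>x. (f has_real_derivative f' x) (at x)" and L: "\<And>x. \<bar>f' x\<bar> \<le> L"
    and F: "\<And>x. (F has_real_derivative f x) (at x)"
  shows "integrable M (\<lambda>x. F (v x))"
proof -
  have [measurable]: "v \<in> borel_measurable M" using v by (simp add: square_integrable_def)
  have cont: "continuous_on UNIV F" using F by (meson DERIV_isCont continuous_at_imp_continuous_on)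
  have [measurable]: "F \<in> borel_measurable borel" using cont by (rule borel_measurable_continuous_onI)
  have v1: "integrable M v"
    using integrable_inner_square[OF v square_integrable_const[OF M, of 1]] by simp
  have v2: "integrable M (\<lambda>x. (v x)\<^sup>2)" using v by (simp add: square_integrable_def)
  have rest: "integrable M (\<lambda>x. F (v x) - F 0 - f 0 * v x)"
  proof (rule Bochner_Integration.integrable_bound)
    show "integrable M (\<lambda>x. L / 2 * (v x)\<^sup>2)" using v2 by simp
    show "AE x in M. norm (F (v x) - F 0 - f 0 * v x) \<le> norm (L / 2 * (v x)\<^sup>2)"
      using primitive_diff_le[OF f L F, of _ 0] by (intro AE_I2) (auto intro: order_trans[OF _ abs_ge_self])
  qed measurable
  have "integrable M (\<lambda>x. (F (v x) - F 0 - f 0 * v x) + (F 0 + f 0 * v x))"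
    by (intro Bochner_Integration.integrable_add rest integrable_mult_right v1 finite_measure.integrable_const M)
  then show ?thesis by simp
qed

lemma square_integrable_lipschitz_comp:
  fixes f v :: "_ \<Rightarrow> real"
  assumes M: "finite_measure M" and v: "square_integrable M v"
    and f: "\<And>x. (f has_real_derivative f' x) (at x)" and L: "\<And>x. \<bar>f' x\<bar> \<le> L"
  shows "square_integrable M (\<lambda>x. f (v x))"
proof -
  have [measurable]: "v \<in> borel_measurable M" using v by (simp add: square_integrable_def)
  have cont: "continuous_on UNIV f" using f by (meson DERIV_isCont continuous_at_imp_continuous_on)
  have [measurable]: "f \<in> borel_measurable borel" using cont by (rule borel_measurable_continuous_onI)
  have "square_integrable M (\<lambda>x. f (v x) - f 0)"
    by (rule square_integrable_bound[OF v, of _ L])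
       (use lipschitz_of_deriv_bound[OF f L, of _ 0] in \<open>auto\<close>)
  from square_integrable_add[OF this square_integrable_const[OF M, of "f 0"]]
  show ?thesis by simp
qed

text \<open>The weighted value \<open>\<sigma> p + (\<alpha> / 2) q\<close> is the midpoint of \<open>p\<close> and \<open>q\<close> shifted by
  \<open>(\<sigma> - 1 / 2) (p - q)\<close>, and \<open>\<sigma> - 1 / 2 = (1 - \<alpha>) / 2\<close> has the dissipative sign.\<close>

lemma gradient_energy_identity:
  fixes p q :: "'a::real_inner"
  assumes "\<sigma> = 1 - \<alpha> / 2"
  shows "((norm p)\<^sup>2 - (norm q)\<^sup>2) / 2
    = (\<sigma> *\<^sub>R p + (\<alpha> / 2) *\<^sub>R q) \<bullet> (p - q) - (1 - \<alpha>) / 2 * (norm (p - q))\<^sup>2"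
  by (simp add: assms power2_norm_eq_inner inner_diff inner_add algebra_simps inner_commute)
     (simp add: field_simps)

text \<open>Here \<open>D\<close> stands for the discrete fractional derivative. The constant \<open>(3 - \<alpha>) / 2\<close> collects
  \<open>L / 2\<close> from the Taylor remainder of the potential and \<open>\<sigma> * L\<close> from the sign-indefinite term
  with \<open>f'\<close>.\<close>

lemma energy_step:
  fixes u0 u1 :: "'a::euclidean_space \<Rightarrow> real" and Du0 Du1 :: "'a \<Rightarrow> 'a" and D :: "'a \<Rightarrow> real"
  assumes \<Omega>: "open \<Omega>" "bounded \<Omega>"
    and \<alpha>: "\<alpha> < 1" and \<sigma>: "\<sigma> = 1 - \<alpha> / 2" and \<sigma>0: "0 \<le> \<sigma>"
    and f: "\<And>x. (f has_real_derivative f' x) (at x)" and L: "\<And>x. \<bar>f' x\<bar> \<le> L"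
    and F: "\<And>x. (F has_real_derivative f x) (at x)"
    and u0: "(u0, Du0) \<in> H1 \<Omega>" and u1: "(u1, Du1) \<in> H1 \<Omega>"
    and eq: "(\<integral>x. D x * (u1 x - u0 x) \<partial>lebesgue_on \<Omega>)
      = \<sigma> * \<nu>\<^sup>2 * laplacian \<Omega> (u1, Du1) (\<lambda>x. u1 x - u0 x, \<lambda>x. Du1 x - Du0 x)
        + (\<alpha> / 2) * \<nu>\<^sup>2 * laplacian \<Omega> (u0, Du0) (\<lambda>x. u1 x - u0 x, \<lambda>x. Du1 x - Du0 x)
        - (\<integral>x. (f (u0 x) + \<sigma> * f' (u0 x) * (u1 x - u0 x)) * (u1 x - u0 x) \<partial>lebesgue_on \<Omega>)"
  shows "energy \<Omega> \<nu> F (u1, Du1) + (\<integral>x. D x * (u1 x - u0 x) \<partial>lebesgue_on \<Omega>)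
    \<le> energy \<Omega> \<nu> F (u0, Du0) + (\<integral>x. (3 - \<alpha>) / 2 * L * (u1 x - u0 x)\<^sup>2 \<partial>lebesgue_on \<Omega>)"
proof -
  let ?M = "lebesgue_on \<Omega>"
  have M: "finite_measure ?M"
    using \<Omega> by (intro finite_measure_lebesgue_on) (simp add: lmeasurable_open)
  define v where "v x = u1 x - u0 x" for x
  define w where "w x = Du1 x - Du0 x" for x
  have sq: "square_integrable ?M u0" "square_integrable ?M u1" "square_integrable ?M Du0" "square_integrable ?M Du1"
    using u0 u1 by (simp_all add: H1_iff)
  have sqv: "square_integrable ?M v" and sqw: "square_integrable ?M w"
    unfolding v_def[abs_def] w_def[abs_def] using sq by (auto intro: square_integrable_diff)
  have v2: "integrable ?M (\<lambda>x. (v x)\<^sup>2)" using sqv by (simp add: square_integrable_def)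
  have [measurable]: "u0 \<in> borel_measurable ?M" "v \<in> borel_measurable ?M"
    "f' \<in> borel_measurable borel"
    using sq sqv deriv_borel_measurable[OF f] by (auto simp: square_integrable_def)
  have "square_integrable ?M (\<lambda>x. \<sigma> * f' (u0 x) * v x)"
  proof (rule square_integrable_bound[OF sqv, of _ "\<sigma> * L"])
    show "norm (\<sigma> * f' (u0 x) * v x) \<le> \<sigma> * L * norm (v x)" for x
      using L[of "u0 x"] \<sigma>0 by (auto simp: abs_mult intro!: mult_right_mono mult_left_mono)
  qed measurable
  from square_integrable_add[OF square_integrable_lipschitz_comp[OF M sq(1) f L] this]
  have react: "integrable ?M (\<lambda>x. (f (u0 x) + \<sigma> * f' (u0 x) * v x) * v x)"
    using integrable_inner_square[OF _ sqv] by simp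
  have lap: "integrable ?M (\<lambda>x. Du1 x \<bullet> w x)" "integrable ?M (\<lambda>x. Du0 x \<bullet> w x)"
    using sq sqw by (auto intro: integrable_inner_square)
  have en: "integrable ?M (\<lambda>x. \<nu>\<^sup>2 / 2 * (norm (Dp x))\<^sup>2 + F (p x))"
    if "square_integrable ?M p" "square_integrable ?M Dp" for p and Dp :: "'a \<Rightarrow> 'a"
    using that(2) integrable_primitive_comp[OF M that(1) f L F] by (auto simp: square_integrable_def)
  have "energy \<Omega> \<nu> F (u1, Du1) - energy \<Omega> \<nu> F (u0, Du0)
      = (\<integral>x. (\<nu>\<^sup>2 / 2 * (norm (Du1 x))\<^sup>2 + F (u1 x)) - (\<nu>\<^sup>2 / 2 * (norm (Du0 x))\<^sup>2 + F (u0 x)) \<partial>?M)"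
    unfolding energy_def fst_conv snd_conv
    by (rule Bochner_Integration.integral_diff[symmetric]) (intro en sq)+
  also have "\<dots> \<le> (\<integral>x. (\<sigma> * \<nu>\<^sup>2 * (Du1 x \<bullet> w x) + \<alpha> / 2 * \<nu>\<^sup>2 * (Du0 x \<bullet> w x))
      + (f (u0 x) + \<sigma> * f' (u0 x) * v x) * v x + (3 - \<alpha>) / 2 * L * (v x)\<^sup>2 \<partial>?M)"
  proof (rule integral_mono)
    fix x
    have "\<nu>\<^sup>2 * (((norm (Du1 x))\<^sup>2 - (norm (Du0 x))\<^sup>2) / 2)
        \<le> \<nu>\<^sup>2 * ((\<sigma> *\<^sub>R Du1 x + (\<alpha> / 2) *\<^sub>R Du0 x) \<bullet> w x)"
      unfolding gradient_energy_identity[OF \<sigma>] w_def using \<alpha> by (intro mult_left_mono) auto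
    moreover have "F (u1 x) - F (u0 x) \<le> f (u0 x) * v x + L / 2 * (v x)\<^sup>2"
      using order_trans[OF abs_ge_self primitive_diff_le[OF f L F, of "u1 x" "u0 x"]]
      unfolding v_def by (simp only: diff_le_eq add.commute)
    moreover have "0 \<le> \<sigma> * (L + f' (u0 x)) * (v x)\<^sup>2"
      using \<sigma>0 L[of "u0 x"] by (intro mult_nonneg_nonneg) auto
    ultimately show "(\<nu>\<^sup>2 / 2 * (norm (Du1 x))\<^sup>2 + F (u1 x)) - (\<nu>\<^sup>2 / 2 * (norm (Du0 x))\<^sup>2 + F (u0 x))
      \<le> (\<sigma> * \<nu>\<^sup>2 * (Du1 x \<bullet> w x) + \<alpha> / 2 * \<nu>\<^sup>2 * (Du0 x \<bullet> w x))
      + (f (u0 x) + \<sigma> * f' (u0 x) * v x) * v x + (3 - \<alpha>) / 2 * L * (v x)\<^sup>2"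
      by (simp add: \<sigma> inner_add_left power2_eq_square field_simps)
  qed (intro Bochner_Integration.integrable_diff Bochner_Integration.integrable_add
      integrable_mult_right en sq react lap v2)+
  also have "\<dots> = \<sigma> * \<nu>\<^sup>2 * (\<integral>x. Du1 x \<bullet> w x \<partial>?M) + \<alpha> / 2 * \<nu>\<^sup>2 * (\<integral>x. Du0 x \<bullet> w x \<partial>?M)
      + (\<integral>x. (f (u0 x) + \<sigma> * f' (u0 x) * v x) * v x \<partial>?M) + (\<integral>x. (3 - \<alpha>) / 2 * L * (v x)\<^sup>2 \<partial>?M)"
    using react lap v2 by simp
  also have "\<dots> = - (\<integral>x. D x * v x \<partial>?M) + (\<integral>x. (3 - \<alpha>) / 2 * L * (v x)\<^sup>2 \<partial>?M)"
    using eq unfolding laplacian_def fst_conv snd_conv v_def[symmetric] w_def[symmetric] by simp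
  finally show ?thesis by (simp add: v_def)
qed

lemma boundary_space_subset_H1:
  assumes "(\<exists>P. period_cell P \<Omega> \<and> V = H1_periodic P \<Omega>) \<or> V = H1_zero \<Omega> \<or> V = H1 \<Omega>"
  shows "V \<subseteq> H1 \<Omega>"
  using assms by (auto simp: H1_zero_def H1_periodic_def)

lemma boundary_space_diff:
  assumes "open \<Omega>" and V: "(\<exists>P. period_cell P \<Omega> \<and> V = H1_periodic P \<Omega>) \<or> V = H1_zero \<Omega> \<or> V = H1 \<Omega>"
    and "(v, Dv) \<in> V" "(w, Dw) \<in> V"
  shows "(\<lambda>x. v x - w x, \<lambda>x. Dv x - Dw x) \<in> V"
  using V
proof (elim disjE exE conjE)
  fix P assume "V = H1_periodic P \<Omega>"
  then show ?thesis using assms by (simp add: H1_periodic_diff)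
next
  assume "V = H1_zero \<Omega>"
  then show ?thesis using assms by (simp add: H1_zero_diff)
next
  assume "V = H1 \<Omega>"
  then show ?thesis using assms by (simp add: H1_diff)
qed

lemma square_integrable_fast_L21sigma:
  assumes u: "\<And>k. square_integrable M (u k)"
  shows "square_integrable M (\<lambda>x. fast_L21sigma \<alpha> \<sigma> Nq \<theta> \<omega> t k (\<lambda>j. u j x))"
  unfolding fast_L21sigma_def delta_def
  by (intro square_integrable_add square_integrable_mult_left square_integrable_sum square_integrable_diff u) simp

section \<open>Energy stability\<close>

theorem theorem4p2:
  fixes \<alpha> \<sigma> \<nu> \<epsilon> \<Delta>t Tsoe L \<eta> :: real
    and Nq :: nat and \<theta> \<omega> :: "nat \<Rightarrow> real"
    and \<Omega> :: "'a::euclidean_space set"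
    and V :: "(('a \<Rightarrow> real) \<times> ('a \<Rightarrow> 'a)) set"
    and f f' F :: "real \<Rightarrow> real"
    and t :: "nat \<Rightarrow> real"
    and u :: "nat \<Rightarrow> 'a \<Rightarrow> real" and Du :: "nat \<Rightarrow> 'a \<Rightarrow> 'a"
  assumes \<alpha>: "0 < \<alpha>" "\<alpha> < 1"
    and \<sigma>: "\<sigma> = 1 - \<alpha> / 2"
    and \<nu>: "0 < \<nu>"
    and domain: "bounded_lipschitz_domain \<Omega>"
    and boundary_condition:
      "(\<exists>P. period_cell P \<Omega> \<and> V = H1_periodic P \<Omega>) \<or> V = H1_zero \<Omega> \<or> V = H1 \<Omega>"
    and soe: "0 < \<epsilon>" "0 < \<Delta>t" "\<Delta>t < Tsoe" "soe_approximation \<alpha> \<epsilon> \<Delta>t Tsoe Nq \<theta> \<omega>"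
    and f': "\<And>x. (f has_real_derivative f' x) (at x)"
    and L: "0 < L" "\<And>x. \<bar>f' x\<bar> \<le> L"
    and F: "\<And>x. (F has_real_derivative f x) (at x)"
    and \<eta>: "0 < \<eta>" "1 - 3 * \<eta>\<^sup>2 * (1 + \<eta>) = 0"
    and mesh: "t 0 = 0" "strict_mono t"
    and ratio: "\<And>k. 2 \<le> k \<Longrightarrow> \<eta> \<le> tau t k / tau t (k - 1)"
    and \<epsilon>_le: "\<And>k. 1 \<le> k \<Longrightarrow> \<epsilon> \<le> 1 / (5 * (1 - \<alpha>) * (\<sigma> * tau t k) powr \<alpha>)"
    and \<Delta>t_le: "\<And>k. 2 \<le> k \<Longrightarrow> \<Delta>t \<le> \<sigma> * tau t k"
    and Tsoe_ge: "\<And>k. 2 \<le> k \<Longrightarrow> \<sigma> * tau t (k + 1) + tau t k \<le> Tsoe"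
    and first_step: "tau t 1 powr \<alpha> \<le>
          (2 - \<alpha> - (1 - \<alpha>) * \<eta> powr (-\<alpha>)) /
          (\<sigma> powr \<alpha> * ((3 - \<alpha>) * Gamma (2 - \<alpha>) * L + (1 - \<alpha>) * \<epsilon>))"
    and steps: "\<And>k. 2 \<le> k \<Longrightarrow> tau t k powr \<alpha> \<le>
          (1 - (1 - \<alpha>) * \<sigma> powr \<alpha> * ((\<sigma> * \<eta>) powr (-\<alpha>) - (\<sigma> * \<eta> + 1) powr (-\<alpha>))) /
          (\<sigma> powr \<alpha> * ((3 - \<alpha>) * Gamma (2 - \<alpha>) * L + 3 * (1 - \<alpha>) * \<epsilon>))"
    and u_V: "\<And>k. (u k, Du k) \<in> V"
    and scheme: "\<And>k v Dv. 1 \<le> k \<Longrightarrow> (v, Dv) \<in> V \<Longrightarrow>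
          (\<integral>x. fast_L21sigma \<alpha> \<sigma> Nq \<theta> \<omega> t k (\<lambda>j. u j x) * v x \<partial>lebesgue_on \<Omega>) =
          (1 - \<alpha> / 2) * \<nu>\<^sup>2 * laplacian \<Omega> (u k, Du k) (v, Dv)
          + (\<alpha> / 2) * \<nu>\<^sup>2 * laplacian \<Omega> (u (k - 1), Du (k - 1)) (v, Dv)
          - (\<integral>x. (f (u (k - 1) x) + (1 - \<alpha> / 2) * f' (u (k - 1) x) * delta (\<lambda>j. u j x) k) * v x
               \<partial>lebesgue_on \<Omega>)"
  shows "\<forall>n\<ge>1. energy \<Omega> \<nu> F (u n, Du n) \<le> energy \<Omega> \<nu> F (u 0, Du 0)"
proof -
  let ?M = "lebesgue_on \<Omega>"
  have \<Omega>: "open \<Omega>" "bounded \<Omega>"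
    using domain by (auto simp: bounded_lipschitz_domain_def)
  have H1: "(u k, Du k) \<in> H1 \<Omega>" for k
    using boundary_space_subset_H1[OF boundary_condition] u_V by blast
  have sq: "square_integrable ?M (u k)" for k using H1[of k] by (simp add: H1_iff)
  define v where "v k x = u (Suc k) x - u k x" for k x
  define D where "D k x = fast_L21sigma \<alpha> \<sigma> Nq \<theta> \<omega> t (Suc k) (\<lambda>j. u j x)" for k x
  have sqv: "square_integrable ?M (v k)" for k
    unfolding v_def[abs_def] by (rule square_integrable_diff[OF sq sq])
  have sqD: "square_integrable ?M (D k)" for k
    unfolding D_def[abs_def] by (rule square_integrable_fast_L21sigma[OF sq])
  have Dv: "integrable ?M (\<lambda>x. D k x * v k x)" for k
    using integrable_inner_square[OF sqD sqv] by simp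
  have vv: "integrable ?M (\<lambda>x. (3 - \<alpha>) / 2 * L * (v k x)\<^sup>2)" for k
    using sqv[of k] by (simp add: square_integrable_def)
  have step: "energy \<Omega> \<nu> F (u (Suc k), Du (Suc k)) + (\<integral>x. D k x * v k x \<partial>?M)
      \<le> energy \<Omega> \<nu> F (u k, Du k) + (\<integral>x. (3 - \<alpha>) / 2 * L * (v k x)\<^sup>2 \<partial>?M)" for k
    unfolding v_def
  proof (rule energy_step[OF \<Omega> \<alpha>(2) \<sigma> _ f' L(2) F H1 H1])
    show "0 \<le> \<sigma>" using \<alpha> \<sigma> by simp
    have "(\<lambda>x. u (Suc k) x - u k x, \<lambda>x. Du (Suc k) x - Du k x) \<in> V"
      by (rule boundary_space_diff[OF \<Omega>(1) boundary_condition u_V u_V])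
    from scheme[OF _ this, of "Suc k"]
    show "(\<integral>x. D k x * (u (Suc k) x - u k x) \<partial>?M)
      = \<sigma> * \<nu>\<^sup>2 * laplacian \<Omega> (u (Suc k), Du (Suc k)) (\<lambda>x. u (Suc k) x - u k x, \<lambda>x. Du (Suc k) x - Du k x)
        + (\<alpha> / 2) * \<nu>\<^sup>2 * laplacian \<Omega> (u k, Du k) (\<lambda>x. u (Suc k) x - u k x, \<lambda>x. Du (Suc k) x - Du k x)
        - (\<integral>x. (f (u k x) + \<sigma> * f' (u k x) * (u (Suc k) x - u k x)) * (u (Suc k) x - u k x) \<partial>?M)"
      by (simp add: D_def delta_def \<sigma>)
  qed
  have telescope: "energy \<Omega> \<nu> F (u n, Du n) + (\<Sum>k<n. \<integral>x. D k x * v k x \<partial>?M)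
      \<le> energy \<Omega> \<nu> F (u 0, Du 0) + (\<Sum>k<n. \<integral>x. (3 - \<alpha>) / 2 * L * (v k x)\<^sup>2 \<partial>?M)" for n
  proof (induction n)
    case (Suc n)
    with step[of n] show ?case by (simp only: sum.lessThan_Suc)
  qed simp
  have dissipation: "(\<Sum>k<n. \<integral>x. (3 - \<alpha>) / 2 * L * (v k x)\<^sup>2 \<partial>?M) \<le> (\<Sum>k<n. \<integral>x. D k x * v k x \<partial>?M)" for n
  proof -
    have "(\<integral>x. (\<Sum>k<n. (3 - \<alpha>) / 2 * L * (v k x)\<^sup>2) \<partial>?M) \<le> (\<integral>x. (\<Sum>k<n. D k x * v k x) \<partial>?M)"
    proof (rule integral_mono)
      fix x
      show "(\<Sum>k<n. (3 - \<alpha>) / 2 * L * (v k x)\<^sup>2) \<le> (\<Sum>k<n. D k x * v k x)"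
        using fast_L21sigma_coercive[OF \<alpha> \<sigma> soe(1,4) L(1) \<eta> mesh(2) ratio \<Delta>t_le Tsoe_ge first_step steps,
            where n = n and y = "\<lambda>j. u j x"]
        by (simp add: sum.atLeast1_atMost_eq D_def v_def delta_def)
    qed (intro Bochner_Integration.integrable_sum Dv vv)+
    then show ?thesis
      unfolding Bochner_Integration.integral_sum[OF vv] Bochner_Integration.integral_sum[OF Dv] .
  qed
  show ?thesis
  proof (intro allI impI)
    fix n :: nat
    show "energy \<Omega> \<nu> F (u n, Du n) \<le> energy \<Omega> \<nu> F (u 0, Du 0)"
      using telescope[of n] dissipation[of n] by linarith
  qed
qed

end
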